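(* Let $k$ be a number field and let $E_1, E_2$ be elliptic curves over $k$ whose $j$-invariants are not both $0$ and not both $1728$. Then $2\in\delta(E_1\times E_2/k)$. If $E_i[2]\subset E_i(k)$ for $i=1,2$, then $2\in\delta(E_1\times E_2/k)$ without any assumption on the $j$-invariants.
   Context: $\delta(X/k)$ is the set of positive integers $d$ such that the closed points of $X$ of degree $d$ over $k$ are Zariski dense in $X$. *)

theory Defs
  imports
    "HOL-Analysis.Analysis"
    "HOL-Library.Poly_Mapping"
    "HOL-Algebra.Algebraic_Closure_Type"
begin

section \<open>Number fields\<close>

text \<open>A number field is a field of characteristic zero that is spanned over the rationals by a
  finite set; the ground field \<open>k\<close> is a type of this class.\<close>

class number_field = field_char_0 +
  assumes finite_degree_over_rat:
    "\<exists>B. finite B \<and> (\<forall>x. \<exists>q :: 'a \<Rightarrow> rat. x = (\<Sum>b\<in>B. of_rat (q b) * b))"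

instance rat :: number_field
  by standard (rule exI[of _ "{1}"], auto)


section \<open>Elliptic curves\<close>

text \<open>The Weierstrass equation
  \<open>y\<^sup>2 + a\<^sub>1xy + a\<^sub>3y = x\<^sup>3 + a\<^sub>2x\<^sup>2 + a\<^sub>4x + a\<^sub>6\<close>.\<close>

datatype 'a weierstrass =
  Weierstrass (a\<^sub>1: 'a) (a\<^sub>2: 'a) (a\<^sub>3: 'a) (a\<^sub>4: 'a) (a\<^sub>6: 'a)

definition b2 :: "'a::field weierstrass \<Rightarrow> 'a"
  where "b2 E = (a\<^sub>1 E)\<^sup>2 + 4 * a\<^sub>2 E"

definition b4 :: "'a::field weierstrass \<Rightarrow> 'a"
  where "b4 E = 2 * a\<^sub>4 E + a\<^sub>1 E * a\<^sub>3 E"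

definition b6 :: "'a::field weierstrass \<Rightarrow> 'a"
  where "b6 E = (a\<^sub>3 E)\<^sup>2 + 4 * a\<^sub>6 E"

definition b8 :: "'a::field weierstrass \<Rightarrow> 'a"
  where "b8 E = (a\<^sub>1 E)\<^sup>2 * a\<^sub>6 E + 4 * a\<^sub>2 E * a\<^sub>6 E - a\<^sub>1 E * a\<^sub>3 E * a\<^sub>4 E
    + a\<^sub>2 E * (a\<^sub>3 E)\<^sup>2 - (a\<^sub>4 E)\<^sup>2"

definition c4 :: "'a::field weierstrass \<Rightarrow> 'a"
  where "c4 E = (b2 E)\<^sup>2 - 24 * b4 E"

definition discriminant :: "'a::field weierstrass \<Rightarrow> 'a"
  where "discriminant E =
    - (b2 E)\<^sup>2 * b8 E - 8 * b4 E ^ 3 - 27 * (b6 E)\<^sup>2 + 9 * b2 E * b4 E * b6 E"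

definition elliptic_curve :: "'a::field weierstrass \<Rightarrow> bool"
  where "elliptic_curve E \<longleftrightarrow> discriminant E \<noteq> 0"

definition j_invariant :: "'a::field weierstrass \<Rightarrow> 'a"
  where "j_invariant E = c4 E ^ 3 / discriminant E"

text \<open>The only point of a Weierstrass cubic on the line at infinity is \<open>(0 : 1 : 0)\<close>, so the
  points are this one and the affine solutions of the equation.\<close>

datatype 'a ec_point = Infinity | Affine 'a 'a

fun on_curve :: "'a::field weierstrass \<Rightarrow> 'a ec_point \<Rightarrow> bool" where
  "on_curve E Infinity \<longleftrightarrow> True"
| "on_curve E (Affine x y) \<longleftrightarrow>
     y\<^sup>2 + a\<^sub>1 E * x * y + a\<^sub>3 E * y = x ^ 3 + a\<^sub>2 E * x\<^sup>2 + a\<^sub>4 E * x + a\<^sub>6 E"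

definition points :: "'a::field weierstrass \<Rightarrow> 'a ec_point set"
  where "points E = {P. on_curve E P}"

definition geometric_points :: "'k::field weierstrass \<Rightarrow> 'k alg_closure ec_point set"
  where "geometric_points E = points (map_weierstrass to_ac E)"

definition rational_points :: "'k::field weierstrass \<Rightarrow> 'k alg_closure ec_point set"
  where "rational_points E = map_ec_point to_ac ` points E"

text \<open>The chord-tangent law with neutral element \<open>Infinity\<close>; \<open>l\<close> is the slope of the line
  through the two points (of the tangent line if they coincide).\<close>

fun ec_add :: "'a::field weierstrass \<Rightarrow> 'a ec_point \<Rightarrow> 'a ec_point \<Rightarrow> 'a ec_point" where
  "ec_add E Infinity Q = Q"
| "ec_add E (Affine x1 y1) Infinity = Affine x1 y1"
| "ec_add E (Affine x1 y1) (Affine x2 y2) =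
     (if x1 = x2 \<and> y1 + y2 + a\<^sub>1 E * x2 + a\<^sub>3 E = 0 then Infinity
      else let
        l = (if x1 = x2
             then (3 * x1\<^sup>2 + 2 * a\<^sub>2 E * x1 + a\<^sub>4 E - a\<^sub>1 E * y1) / (2 * y1 + a\<^sub>1 E * x1 + a\<^sub>3 E)
             else (y2 - y1) / (x2 - x1));
        x3 = l\<^sup>2 + a\<^sub>1 E * l - a\<^sub>2 E - x1 - x2
      in Affine x3 (- (l + a\<^sub>1 E) * x3 - (y1 - l * x1) - a\<^sub>3 E))"

text \<open>The \<open>n\<close>-torsion \<open>E[n]\<close>, over the algebraic closure.\<close>

definition torsion :: "nat \<Rightarrow> 'k::field weierstrass \<Rightarrow> 'k alg_closure ec_point set"
  where "torsion n E =
    {P \<in> geometric_points E. (ec_add (map_weierstrass to_ac E) P ^^ n) Infinity = Infinity}"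


section \<open>Closed points and their degrees\<close>

text \<open>Since \<open>k\<close> is perfect, the closed points of a \<open>k\<close>-variety are the orbits of its geometric
  points under the absolute Galois group. Below, \<open>V\<close> is always the set of geometric points of a
  closed \<open>k\<close>-subvariety of a product of two Weierstrass curves over \<open>k\<close>.\<close>

type_synonym 'k geo_point = "'k alg_closure ec_point \<times> 'k alg_closure ec_point"

definition absolute_galois :: "('k::field alg_closure \<Rightarrow> 'k alg_closure) set"
  where "absolute_galois = {\<sigma>. bij \<sigma> \<and> (\<forall>x y. \<sigma> (x + y) = \<sigma> x + \<sigma> y) \<and>
    (\<forall>x y. \<sigma> (x * y) = \<sigma> x * \<sigma> y) \<and> (\<forall>a. \<sigma> (to_ac a) = to_ac a)}"

definition galois_orbit :: "'k::field geo_point \<Rightarrow> 'k geo_point set"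
  where "galois_orbit P =
    (\<lambda>\<sigma>. map_prod (map_ec_point \<sigma>) (map_ec_point \<sigma>) P) ` absolute_galois"

definition closed_points :: "'k::field geo_point set \<Rightarrow> 'k geo_point set set"
  where "closed_points V = galois_orbit ` V"

text \<open>The subfield \<open>k(S)\<close> of the algebraic closure.\<close>

inductive_set field_adjoin :: "'k::field alg_closure set \<Rightarrow> 'k alg_closure set"
  for S :: "'k alg_closure set" where
  base: "to_ac a \<in> field_adjoin S"
| gen: "x \<in> S \<Longrightarrow> x \<in> field_adjoin S"
| diff: "x \<in> field_adjoin S \<Longrightarrow> y \<in> field_adjoin S \<Longrightarrow> x - y \<in> field_adjoin S"
| mult: "x \<in> field_adjoin S \<Longrightarrow> y \<in> field_adjoin S \<Longrightarrow> x * y \<in> field_adjoin S"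
| inverse: "x \<in> field_adjoin S \<Longrightarrow> inverse x \<in> field_adjoin S"

text \<open>The residue field of the closed point below the geometric point \<open>(P, Q)\<close> is generated by the
  affine coordinates of \<open>P\<close> and \<open>Q\<close>; the point at infinity is rational and contributes none.\<close>

definition residue_field :: "'k::field geo_point \<Rightarrow> 'k alg_closure set"
  where "residue_field P = field_adjoin (set_ec_point (fst P) \<union> set_ec_point (snd P))"

lemma vector_space_alg_closure:
  "vector_space (\<lambda>(a :: 'k::field) (x :: 'k alg_closure). to_ac a * x)"
  by standard (simp_all add: algebra_simps)

definition residue_degree :: "'k::field geo_point \<Rightarrow> nat"
  where "residue_degree P =
    vector_space.dim (\<lambda>(a :: 'k) (x :: 'k alg_closure). to_ac a * x) (residue_field P)"

definition closed_points_of_degree :: "nat \<Rightarrow> 'k::field geo_point set \<Rightarrow> 'k geo_point set set"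
  where "closed_points_of_degree d V = galois_orbit ` {P \<in> V. residue_degree P = d}"


section \<open>The Zariski topology\<close>

text \<open>Polynomials over \<open>k\<close> in the homogeneous coordinates of two projective planes: \<open>Inl i\<close> are
  the variables of the first plane and \<open>Inr i\<close> those of the second.\<close>

type_synonym 'k biplane_poly = "((3 + 3) \<Rightarrow>\<^sub>0 nat) \<Rightarrow>\<^sub>0 'k"

definition bihomogeneous :: "nat \<Rightarrow> nat \<Rightarrow> 'k::field biplane_poly \<Rightarrow> bool"
  where "bihomogeneous d e F \<longleftrightarrow> (\<forall>m \<in> Poly_Mapping.keys F.
    (\<Sum>i\<in>UNIV. Poly_Mapping.lookup m (Inl i)) = d \<and>
    (\<Sum>i\<in>UNIV. Poly_Mapping.lookup m (Inr i)) = e)"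

fun homogeneous_coords :: "'a::field ec_point \<Rightarrow> 'a ^ 3" where
  "homogeneous_coords Infinity = vector [0, 1, 0]"
| "homogeneous_coords (Affine x y) = vector [x, y, 1]"

definition eval_at :: "'k::field biplane_poly \<Rightarrow> 'k geo_point \<Rightarrow> 'k alg_closure"
  where "eval_at F P = (\<Sum>m \<in> Poly_Mapping.keys F. to_ac (Poly_Mapping.lookup F m) *
    (\<Prod>v\<in>UNIV. case_sum (($) (homogeneous_coords (fst P))) (($) (homogeneous_coords (snd P))) v
      ^ Poly_Mapping.lookup m v))"

text \<open>The topology which the Zariski topology of \<open>V\<close> induces on its set of closed points: the
  non-vanishing loci of bihomogeneous polynomials over \<open>k\<close> form a basis. As \<open>V\<close> is a Jacobson
  scheme, a set of closed points is dense in \<open>V\<close> iff it is dense for this topology.\<close>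

definition basic_open :: "'k::field geo_point set \<Rightarrow> 'k biplane_poly \<Rightarrow> 'k geo_point set set"
  where "basic_open V F = galois_orbit ` {P \<in> V. eval_at F P \<noteq> 0}"

definition zariski :: "'k::field geo_point set \<Rightarrow> 'k geo_point set topology"
  where "zariski V =
    topology_generated_by {basic_open V F | F. \<exists>d e. bihomogeneous d e F}"

lemma topspace_zariski: "topspace (zariski V) = closed_points (V :: 'k::field geo_point set)"
proof -
  define F :: "'k biplane_poly" where "F = Poly_Mapping.single 0 1"
  have "bihomogeneous 0 0 F" and "\<And>P. eval_at F P = 1"
    by (simp_all add: F_def bihomogeneous_def eval_at_def)
  hence "basic_open V F = closed_points V" and "\<exists>d e. bihomogeneous d e F"
    by (auto simp: basic_open_def closed_points_def)
  moreover have "basic_open V G \<subseteq> closed_points V" for G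
    by (auto simp: basic_open_def closed_points_def)
  ultimately show ?thesis
    unfolding zariski_def topology_generated_by_topspace by blast
qed

definition \<delta> :: "'k::field geo_point set \<Rightarrow> nat set"
  where "\<delta> V = {d. d > 0 \<and> zariski V closure_of closed_points_of_degree d V = closed_points V}"

end

theory Submission
  imports Defs
begin

text \<open>Complete the squares, so that the curves are \<open>w\<^sup>2 = f x\<close> and \<open>z\<^sup>2 = g u\<close> with monic cubics \<open>f\<close>
  and \<open>g\<close>. There are nonconstant rational functions \<open>\<xi>\<close>, \<open>\<eta>\<close> of a parameter \<open>D\<close> with
  \<open>D ^ 3 * f (\<xi> D) = g (\<eta> D)\<close>: translate both cubics so that their quadratic terms vanish, or so that both
  have a root at 0, and put \<open>\<eta> = D * \<xi>\<close>; the equation becomes linear in \<open>\<xi>\<close>, and the hypotheses say that its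
  solution is not degenerate.

  For \<open>D = t\<^sup>2\<close> the values \<open>c = f (\<xi> D)\<close> and \<open>t ^ 6 * c = g (\<eta> D)\<close> acquire their square roots in the same
  field \<open>k(\<surd>c)\<close>. If \<open>c\<close> is a nonsquare for infinitely many \<open>t\<close>, then the pairs of points over \<open>k(\<surd>c)\<close> are
  made dense by doubling the first point repeatedly. Otherwise both curves have infinitely many
  rational points; taking \<open>D\<close> to be a nonsquare shows that one of them also has infinitely many points with
  rational abscissa that are quadratic, and these are paired with the rational points of the other curve.\<close>

hide_const (open) up_ring.coeff up_ring.monom module.smult
  Polynomials.degree Polynomials.lead_coeff
  Coset.order

section \<open>Nonsquares in number fields\<close>

lemma poly_map_of_rat_add:
  "poly (map_poly of_rat (p + q)) (a :: 'a::field_char_0) =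
     poly (map_poly of_rat p) a + poly (map_poly of_rat q) a"
proof -
  have "map_poly (of_rat :: rat \<Rightarrow> 'a) (p + q) = map_poly of_rat p + map_poly of_rat q"
    by (rule poly_eqI) (simp add: coeff_map_poly of_rat_add)
  thus ?thesis by simp
qed

lemma poly_map_of_rat_mult:
  "poly (map_poly of_rat (p * q)) (a :: 'a::field_char_0) =
     poly (map_poly of_rat p) a * poly (map_poly of_rat q) a"
proof (induction p)
  case (pCons c p)
  have "map_poly (of_rat :: rat \<Rightarrow> 'a) (smult c q) = smult (of_rat c) (map_poly of_rat q)"
    by (rule poly_eqI) (simp add: coeff_map_poly of_rat_mult)
  thus ?case using pCons
    by (simp add: poly_map_of_rat_add map_poly_pCons algebra_simps)
qed simp

lemma poly_map_of_rat_two_root: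
  "poly (map_poly of_rat (monom 1 m - [:2:])) a = a ^ m - (2 :: 'a::field_char_0)"
proof -
  have "map_poly (of_rat :: rat \<Rightarrow> 'a) (monom 1 m - [:2:]) = monom 1 m - [:2:]"
    by (rule poly_eqI) (auto simp: coeff_map_poly of_rat_diff coeff_pCons split: nat.split)
  thus ?thesis by (simp add: poly_monom)
qed

text \<open>The 2-adic valuation of a nonzero \<open>m\<close>-th power is divisible by
  \<open>m\<close>; that of \<open>2 ^ d\<close> is \<open>d\<close>.\<close>

lemma rat_power_neq_two_power:
  fixes r :: rat
  assumes "0 < d" "d < m"
  shows "\<bar>r\<bar> ^ m \<noteq> 2 ^ d"
proof
  assume eq: "\<bar>r\<bar> ^ m = 2 ^ d"
  obtain p q where pq: "quotient_of \<bar>r\<bar> = (p, q)" by fastforce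
  have q: "q > 0" using quotient_of_denom_pos[OF pq] .
  have r: "\<bar>r\<bar> = of_int p / of_int q" using quotient_of_div[OF pq] .
  have "of_int (p ^ m) = (of_int (2 ^ d * q ^ m) :: rat)"
    using eq q unfolding r by (simp add: power_divide field_simps)
  hence *: "p ^ m = 2 ^ d * q ^ m" by (simp only: of_int_eq_iff)
  have p: "p \<noteq> 0" using * q assms by (auto simp: power_0_left)
  have "multiplicity 2 (p ^ m) = m * multiplicity 2 p"
    using p by (simp add: prime_elem_multiplicity_power_distrib)
  moreover have "multiplicity 2 (2 ^ d * q ^ m) = d + m * multiplicity 2 q"
    using q by (simp add: prime_elem_multiplicity_mult_distrib prime_elem_multiplicity_power_distrib)
  ultimately have "m * multiplicity 2 p = d + m * multiplicity 2 q" using * by simp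
  hence "m dvd d" by (metis dvd_add_left_iff dvd_triv_left)
  thus False using assms by (simp add: nat_dvd_not_less)
qed

lemma complex_norm_of_rat: "norm (of_rat q :: complex) = of_rat \<bar>q\<bar>"
  by (cases q) (simp add: of_rat_rat norm_divide)

text \<open>All complex roots of \<open>X ^ m - 2\<close> have the same absolute value, so the constant coefficient of a
  monic rational factor of degree \<open>d\<close> is, up to sign, a rational number with \<open>m\<close>-th power \<open>2 ^ d\<close>.\<close>

lemma no_small_degree_relation:
  fixes a :: "'a::field_char_0"
  assumes am: "a ^ m = 2" and p: "p \<noteq> 0" "degree p < m" "poly (map_poly of_rat p) a = 0"
  shows False
proof -
  define q :: "rat poly" where "q = monom 1 m - [:2:]"
  \<comment> \<open>The gcd with \<open>X ^ m - 2\<close> still has the root \<open>a\<close> by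
    Bezout, so it is a nonconstant rational factor of \<open>X ^ m - 2\<close> of degree below
    \<open>m\<close>.\<close>
  define g where "g = gcd p q"
  obtain u v where uv: "u * p + v * q = g"
    using bezout_coefficients_fst_snd[of p q] unfolding g_def by blast
  have m: "m > 0" using p by auto
  have "poly (map_poly of_rat g) a = 0"
    unfolding uv[symmetric] poly_map_of_rat_add poly_map_of_rat_mult
    using p am by (simp add: q_def poly_map_of_rat_two_root)
  have g0: "g \<noteq> 0" using p by (simp add: g_def)
  have dpos: "degree g > 0"
  proof (rule ccontr)
    assume "\<not> degree g > 0"
    then obtain c where "g = [:c:]" using degree_eq_zeroE by auto
    thus False using \<open>poly (map_poly of_rat g) a = 0\<close> g0 by (simp add: map_poly_pCons)
  qed
  have dlt: "degree g < m" using p dvd_imp_degree_le[of g p] by (simp add: g_def)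
  obtain h where h: "q = g * h" unfolding g_def by (meson dvdE gcd_dvd2)
  define G :: "complex poly" where "G = map_poly of_rat g"
  have degG: "degree G = degree g" unfolding G_def by (intro degree_map_poly) auto
  have lcG: "lead_coeff G = of_rat (lead_coeff g)"
    unfolding degG by (simp add: G_def coeff_map_poly)
  have "G \<noteq> 0" using lcG g0 by auto
  from alg_closed_imp_factorization[OF this] obtain A where A: "size A = degree G"
    "G = smult (lead_coeff G) (\<Prod>x\<in>#A. [:-x, 1:])" by blast
  have nx: "norm x ^ m = 2" if "x \<in># A" for x
  proof -
    from that have "poly G x = 0"
      by (subst A(2)) (auto simp: poly_prod_mset)
    hence "poly (map_poly of_rat q) x = 0" unfolding h poly_map_of_rat_mult by (simp add: G_def)
    hence "x ^ m = 2" by (simp add: q_def poly_map_of_rat_two_root)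
    thus ?thesis by (metis norm_power norm_numeral)
  qed
  have "poly G 0 = lead_coeff G * (\<Prod>x\<in>#A. - x)"
    by (subst A(2)) (simp add: poly_prod_mset)
  moreover have "poly G 0 = of_rat (coeff g 0)"
    by (simp add: G_def poly_0_coeff_0 coeff_map_poly)
  ultimately have "of_rat (coeff g 0 / lead_coeff g) = (\<Prod>x\<in>#A. - x :: complex)"
    using g0 unfolding lcG by (simp add: of_rat_divide)
  moreover have "norm (\<Prod>x\<in>#A. - x :: complex) ^ m = 2 ^ size A" using nx
    by (induction A) (auto simp: norm_mult power_mult_distrib)
  ultimately have "norm (of_rat (coeff g 0 / lead_coeff g) :: complex) ^ m = 2 ^ degree g"
    using A degG by simp
  hence "(real_of_rat \<bar>coeff g 0 / lead_coeff g\<bar>) ^ m = 2 ^ degree g"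
    by (simp add: complex_norm_of_rat)
  hence "real_of_rat (\<bar>coeff g 0 / lead_coeff g\<bar> ^ m) = of_rat (2 ^ degree g)"
    by (simp only: of_rat_power of_rat_numeral_eq)
  hence "\<bar>coeff g 0 / lead_coeff g\<bar> ^ m = 2 ^ degree g" by (simp only: of_rat_eq_iff)
  thus False using rat_power_neq_two_power dpos dlt by blast
qed

text \<open>The powers of \<open>a\<close> up to \<open>a ^ card B\<close> are one too many to be
  independent over the rationals; the point is that \<open>card B\<close> does not depend on
  \<open>a\<close>.\<close>

lemma number_field_annihilator:
  "\<exists>n. \<forall>a :: 'k::number_field. \<exists>p. p \<noteq> 0 \<and> degree p \<le> n \<and> poly (map_poly of_rat p) a = 0"
proof -
  interpret V: vector_space "\<lambda>(q :: rat) (x :: 'k). of_rat q * x"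
    by standard (simp_all add: algebra_simps of_rat_add of_rat_mult)
  obtain B :: "'k set" where B: "finite B" "\<And>x. \<exists>q :: 'k \<Rightarrow> rat. x = (\<Sum>b\<in>B. of_rat (q b) * b)"
    using finite_degree_over_rat by blast
  have span: "x \<in> V.span B" for x
  proof -
    obtain q where x: "x = (\<Sum>b\<in>B. of_rat (q b) * b)" using B(2) by blast
    show ?thesis unfolding x by (intro V.span_sum V.span_scale V.span_base)
  qed
  show ?thesis
  proof (intro exI[of _ "card B"] allI)
    fix a :: 'k
    have eval: "poly (map_poly of_rat (\<Sum>i\<in>I. monom (c i) i)) a = (\<Sum>i\<in>I. of_rat (c i) * a ^ i)"
      if "finite I" for c and I :: "nat set"
      using that by induction (simp_all add: poly_map_of_rat_add map_poly_monom poly_monom)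
    show "\<exists>p. p \<noteq> 0 \<and> degree p \<le> card B \<and> poly (map_poly of_rat p) a = 0"
    proof (cases "inj_on (\<lambda>i. a ^ i) {..card B}")
      case True
      hence "card ((\<lambda>i. a ^ i) ` {..card B}) = Suc (card B)" by (simp add: card_image)
      hence "V.dependent ((\<lambda>i. a ^ i) ` {..card B})"
        using V.independent_span_bound[OF B(1), of "(\<lambda>i. a ^ i) ` {..card B}"] span by fastforce
      then obtain u where u: "\<exists>v\<in>(\<lambda>i. a ^ i) ` {..card B}. u v \<noteq> 0"
        "(\<Sum>v\<in>(\<lambda>i. a ^ i) ` {..card B}. of_rat (u v) * v) = 0"
        by (subst (asm) V.dependent_finite) auto
      define p where "p = (\<Sum>i\<le>card B. monom (u (a ^ i)) i)"
      have c: "coeff p i = (if i \<le> card B then u (a ^ i) else 0)" for i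
        by (simp add: p_def coeff_sum if_distrib sum.delta cong: if_cong)
      obtain i where "i \<le> card B" "u (a ^ i) \<noteq> 0" using u(1) by auto
      hence "coeff p i \<noteq> 0" by (simp add: c)
      hence "p \<noteq> 0" by auto
      moreover have "degree p \<le> card B" by (rule degree_le) (simp add: c)
      moreover have "poly (map_poly of_rat p) a = 0"
        using u(2) True unfolding p_def by (subst eval) (simp_all add: sum.reindex)
      ultimately show ?thesis by blast
    next
      \<comment> \<open>With coinciding powers the dimension count breaks down, but the coincidence
        is itself a relation.\<close>
      case False
      then obtain i j where ij: "i < j" "j \<le> card B" "a ^ i = a ^ j"
        unfolding inj_on_def by (metis atMost_iff linorder_neqE_nat)
      define p :: "rat poly" where "p = monom 1 j + monom (-1) i"
      have "coeff p j = 1" using ij by (simp add: p_def)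
      hence "p \<noteq> 0" by auto
      moreover have "degree p \<le> card B" using ij
        unfolding p_def by (intro degree_add_le) (auto intro: order.trans[OF degree_monom_le])
      moreover have "poly (map_poly of_rat p) a = 0"
        using ij by (simp add: p_def poly_map_of_rat_add map_poly_monom poly_monom)
      ultimately show ?thesis by blast
    qed
  qed
qed

text \<open>If every element were a square, iterated square roots of 2 would reach an
  \<open>a\<close> with \<open>a ^ (2 ^ n) = 2\<close>, whose degree \<open>2 ^ n\<close> exceeds
  the uniform bound \<open>n\<close>.\<close>

lemma number_field_nonsquare: "\<exists>D :: 'k::number_field. \<nexists>r. D = r\<^sup>2"
proof (rule ccontr)
  assume "\<not> ?thesis"
  hence sq: "\<exists>r. D = r\<^sup>2" for D :: 'k by blast
  have root: "\<exists>a :: 'k. a ^ (2 ^ j) = 2" for j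
  proof (induction j)
    case (Suc j)
    then obtain a :: 'k where a: "a ^ (2 ^ j) = 2" by blast
    obtain r where "a = r\<^sup>2" using sq by blast
    thus ?case using a by (intro exI[of _ r]) (simp add: power_mult)
  qed simp
  obtain n where n: "\<And>a :: 'k. \<exists>p. p \<noteq> 0 \<and> degree p \<le> n \<and> poly (map_poly of_rat p) a = 0"
    using number_field_annihilator by blast
  obtain a :: 'k where "a ^ (2 ^ n) = 2" using root by blast
  moreover obtain p where "p \<noteq> 0" "degree p \<le> n" "poly (map_poly of_rat p) a = 0"
    using n[of a] by blast
  moreover have "n < 2 ^ n" by simp
  ultimately show False using no_small_degree_relation[of a "2 ^ n" p] by linarith
qed

section \<open>Doubling\<close>

text \<open>The coefficient \<open>c\<close> may be 0, so \<open>n\<close> only bounds the degree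
  and sums with cancelling leading terms cause no case distinction.\<close>

definition top_coeff :: "'a::idom poly \<Rightarrow> nat \<Rightarrow> 'a \<Rightarrow> bool"
  where "top_coeff p n c \<longleftrightarrow> degree p \<le> n \<and> coeff p n = c"

lemma top_coeff_add: "top_coeff p n c \<Longrightarrow> top_coeff q n d \<Longrightarrow> top_coeff (p + q) n (c + d)"
  by (auto simp: top_coeff_def intro: degree_add_le)

lemma top_coeff_diff: "top_coeff p n c \<Longrightarrow> top_coeff q n d \<Longrightarrow> top_coeff (p - q) n (c - d)"
  by (auto simp: top_coeff_def intro: degree_diff_le)

lemma top_coeff_mult:
  assumes "top_coeff p m c" "top_coeff q n d"
  shows "top_coeff (p * q) (m + n) (c * d)"
proof -
  have deg: "degree (p * q) \<le> m + n"
    using assms degree_mult_le[of p q] by (auto simp: top_coeff_def)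
  show ?thesis
  proof (cases "degree p = m \<and> degree q = n")
    case True
    thus ?thesis using assms deg coeff_mult_degree_sum[of p q] by (auto simp: top_coeff_def)
  next
    case False
    hence "degree p < m \<or> degree q < n" using assms by (auto simp: top_coeff_def)
    hence "c * d = 0" "degree (p * q) < m + n"
      using assms degree_mult_le[of p q] by (auto simp: top_coeff_def coeff_eq_0)
    thus ?thesis by (simp add: top_coeff_def coeff_eq_0)
  qed
qed

lemma top_coeff_power: "top_coeff p m c \<Longrightarrow> top_coeff (p ^ n) (n * m) (c ^ n)"
proof (induction n)
  case (Suc n)
  thus ?case using top_coeff_mult[of p m c "p ^ n" "n * m" "c ^ n"] by simp
qed (simp add: top_coeff_def)

lemma top_coeff_smult: "top_coeff p n c \<Longrightarrow> top_coeff (smult a p) n (a * c)"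
  by (auto simp: top_coeff_def intro: order.trans[OF degree_smult_le])

lemma top_coeff_less: "top_coeff p m c \<Longrightarrow> m < n \<Longrightarrow> top_coeff p n 0"
  by (auto simp: top_coeff_def coeff_eq_0)

section \<open>The duplication map on abscissae\<close>

definition cub :: "'a::field \<Rightarrow> 'a \<Rightarrow> 'a \<Rightarrow> 'a \<Rightarrow> 'a"
  where "cub a b c x = x ^ 3 + a * x\<^sup>2 + b * x + c"

definition cub_deriv :: "'a::field \<Rightarrow> 'a \<Rightarrow> 'a \<Rightarrow> 'a"
  where "cub_deriv a b x = 3 * x\<^sup>2 + 2 * a * x + b"

text \<open>The abscissa of the double of a point of \<open>w\<^sup>2 = f x\<close>, where \<open>f = cub a b c\<close>.\<close>

definition dbl :: "'a::field \<Rightarrow> 'a \<Rightarrow> 'a \<Rightarrow> 'a \<Rightarrow> 'a"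
  where "dbl a b c x = (cub_deriv a b x)\<^sup>2 / (4 * cub a b c x) - a - 2 * x"

text \<open>Doubling preserves the class of \<open>f x\<close> modulo squares: with
  \<open>F = f x\<close> and \<open>e\<close> the derivative at \<open>x\<close>, Taylor expansion
  makes \<open>4 * F * f y\<close> the square of \<open>2 * F + e * (y - x)\<close>, because the
  tangent line meets the curve over \<open>y\<close>.\<close>

lemma cub_dbl:
  fixes x :: "'a::field_char_0"
  assumes "cub a b c x \<noteq> 0"
  shows "\<exists>r. cub a b c (dbl a b c x) = r\<^sup>2 * cub a b c x"
proof -
  define F where "F = cub a b c x"
  define e where "e = cub_deriv a b x"
  define y where "y = dbl a b c x"
  have F: "F \<noteq> 0" using assms by (simp add: F_def)
  have y: "4 * F * (y + a + 2 * x) = e\<^sup>2"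
    using F by (simp add: y_def dbl_def F_def[symmetric] e_def[symmetric])
  \<comment> \<open>Exact for a monic cubic: the quadratic and cubic terms have coefficients
    \<open>3 * x + a\<close> and \<open>1\<close>, and \<open>3 * x + a + (y - x)\<close> is
    \<open>y + a + 2 * x\<close>.\<close>
  have taylor: "cub a b c y = F + e * (y - x) + (y + a + 2 * x) * (y - x)\<^sup>2"
    by (simp add: F_def e_def cub_def cub_deriv_def algebra_simps eval_nat_numeral)
  have "4 * F * cub a b c y = 4 * F\<^sup>2 + 4 * F * e * (y - x) + e\<^sup>2 * (y - x)\<^sup>2"
    unfolding taylor y[symmetric] by (simp add: algebra_simps power2_eq_square)
  also have "\<dots> = (2 * F + e * (y - x))\<^sup>2" by (simp add: algebra_simps power2_eq_square)
  finally have "4 * F * cub a b c y = (2 * F + e * (y - x))\<^sup>2" .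
  hence "cub a b c y = (2 * F + e * (y - x))\<^sup>2 / (4 * F)"
    using F by (simp add: eq_divide_eq mult.commute)
  also have "\<dots> = ((2 * F + e * (y - x)) / (2 * F))\<^sup>2 * F"
    using F by (simp add: power_divide power2_eq_square)
  finally have "cub a b c y = ((2 * F + e * (y - x)) / (2 * F))\<^sup>2 * F" .
  thus ?thesis unfolding y_def F_def by blast
qed

text \<open>Numerator and denominator of the abscissa after \<open>n\<close> doublings, not reduced
  to lowest terms.\<close>

primrec dbl_poly :: "'a::field \<Rightarrow> 'a \<Rightarrow> 'a \<Rightarrow> nat \<Rightarrow> 'a poly \<times> 'a poly" where
  "dbl_poly a b c 0 = ([:0, 1:], 1)"
| "dbl_poly a b c (Suc n) = (case dbl_poly a b c n of (P, Q) \<Rightarrow>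
     (P ^ 4 - smult (2 * b) (P\<^sup>2 * Q\<^sup>2) - smult (8 * c) (P * Q ^ 3)
        + smult (b\<^sup>2 - 4 * a * c) (Q ^ 4),
      smult 4 (Q * (P ^ 3 + smult a (P\<^sup>2 * Q) + smult b (P * Q\<^sup>2) + smult c (Q ^ 3)))))"

text \<open>To leading order at infinity doubling divides the abscissa by 4, so the
  \<open>n\<close>-fold iterate grows like \<open>x / 4 ^ n\<close>. These rates tell the iterates
  apart.\<close>

lemma dbl_poly_top:
  fixes a :: "'a::field_char_0"
  shows "\<exists>d \<alpha>. \<alpha> \<noteq> 0 \<and> top_coeff (fst (dbl_poly a b c n)) (Suc d) \<alpha> \<and>
    top_coeff (snd (dbl_poly a b c n)) d (4 ^ n * \<alpha>)"
proof (induction n)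
  case 0
  show ?case by (rule exI[of _ 0], rule exI[of _ 1]) (simp add: top_coeff_def)
next
  case (Suc n)
  obtain P Q where PQ: "dbl_poly a b c n = (P, Q)" by fastforce
  define \<beta> :: "nat \<Rightarrow> 'a \<Rightarrow> 'a" where "\<beta> n \<alpha> = 4 ^ n * \<alpha>" for n \<alpha>
  from Suc obtain d \<alpha> where 0: "\<alpha> \<noteq> 0" "top_coeff P (Suc d) \<alpha>" "top_coeff Q d (\<beta> n \<alpha>)"
    unfolding PQ \<beta>_def by auto
  note P = top_coeff_power[OF 0(2)] and Q = top_coeff_power[OF 0(3)]
  \<comment> \<open>All other terms contain a factor \<open>Q\<close> and stay below degree
    \<open>4 * d + 4\<close>; likewise for the cubic form that follows.\<close>
  have "top_coeff (P ^ 4 - smult (2 * b) (P\<^sup>2 * Q\<^sup>2) - smult (8 * c) (P * Q ^ 3)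
        + smult (b\<^sup>2 - 4 * a * c) (Q ^ 4)) (4 * d + 4)
        (\<alpha> ^ 4 - 2 * b * 0 - 8 * c * 0 + (b\<^sup>2 - 4 * a * c) * 0)"
    using P[of 4] top_coeff_mult[OF P[of 2] Q[of 2]] top_coeff_mult[OF P[of 1] Q[of 3]] Q[of 4]
    by (intro top_coeff_add top_coeff_diff top_coeff_smult)
      (auto elim!: top_coeff_less simp: algebra_simps)
  hence 1: "top_coeff (fst (dbl_poly a b c (Suc n))) (Suc (4 * d + 3)) (\<alpha> ^ 4)"
    by (simp add: PQ algebra_simps)
  have "top_coeff (P ^ 3 + smult a (P\<^sup>2 * Q) + smult b (P * Q\<^sup>2) + smult c (Q ^ 3)) (3 * d + 3)
        (\<alpha> ^ 3 + a * 0 + b * 0 + c * 0)"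
    using P[of 3] top_coeff_mult[OF P[of 2] Q[of 1]] top_coeff_mult[OF P[of 1] Q[of 2]] Q[of 3]
    by (intro top_coeff_add top_coeff_smult)
      (auto elim!: top_coeff_less simp: algebra_simps)
  from top_coeff_smult[OF top_coeff_mult[OF 0(3) this], of 4]
  have 2: "top_coeff (snd (dbl_poly a b c (Suc n))) (4 * d + 3) (4 ^ Suc n * \<alpha> ^ 4)"
    by (simp add: PQ \<beta>_def algebra_simps eval_nat_numeral)
  show ?case using 0(1) 1 2
    by (intro exI[of _ "4 * d + 3"] exI[of _ "\<alpha> ^ 4"]) auto
qed

lemma cub_divide:
  assumes "q \<noteq> 0"
  shows "cub a b c (p / q) = (p ^ 3 + a * (p\<^sup>2 * q) + b * (p * q\<^sup>2) + c * q ^ 3) / q ^ 3"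
  using assms by (simp add: cub_def field_simps power2_eq_square power3_eq_cube)

lemma dbl_divide:
  fixes p :: "'a::field_char_0"
  assumes "q \<noteq> 0" "p ^ 3 + a * (p\<^sup>2 * q) + b * (p * q\<^sup>2) + c * q ^ 3 \<noteq> 0"
  shows "dbl a b c (p / q) =
    (p ^ 4 - 2 * b * (p\<^sup>2 * q\<^sup>2) - 8 * c * (p * q ^ 3) + (b\<^sup>2 - 4 * a * c) * q ^ 4) /
    (4 * (q * (p ^ 3 + a * (p\<^sup>2 * q) + b * (p * q\<^sup>2) + c * q ^ 3)))"
proof -
  define m where "m = p ^ 3 + a * (p\<^sup>2 * q) + b * (p * q\<^sup>2) + c * q ^ 3"
  have m: "m \<noteq> 0" using assms m_def by simp
  have d: "cub_deriv a b (p / q) = (3 * p\<^sup>2 + 2 * a * (p * q) + b * q\<^sup>2) / q\<^sup>2"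
    using assms by (simp add: cub_deriv_def field_simps power2_eq_square)
  have "dbl a b c (p / q) = (3 * p\<^sup>2 + 2 * a * (p * q) + b * q\<^sup>2)\<^sup>2 / (4 * (q * m)) - a - 2 * (p / q)"
    unfolding dbl_def cub_divide[OF assms(1)] m_def[symmetric] d
    using m assms(1) by (simp add: power_divide field_simps eval_nat_numeral)
  also have "\<dots> = ((3 * p\<^sup>2 + 2 * a * (p * q) + b * q\<^sup>2)\<^sup>2 - 4 * (a * q + 2 * p) * m) / (4 * (q * m))"
    using m assms(1) by (simp add: field_simps)
  also have "(3 * p\<^sup>2 + 2 * a * (p * q) + b * q\<^sup>2)\<^sup>2 - 4 * (a * q + 2 * p) * m =
     p ^ 4 - 2 * b * (p\<^sup>2 * q\<^sup>2) - 8 * c * (p * q ^ 3) + (b\<^sup>2 - 4 * a * c) * q ^ 4"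
    unfolding m_def by (simp add: algebra_simps eval_nat_numeral)
  finally show ?thesis unfolding m_def .
qed

lemma dbl_iterate:
  fixes x :: "'a::field_char_0"
  assumes "\<And>i. i \<le> n \<Longrightarrow> poly (snd (dbl_poly a b c i)) x \<noteq> 0"
  shows "(dbl a b c ^^ n) x = poly (fst (dbl_poly a b c n)) x / poly (snd (dbl_poly a b c n)) x \<and>
    (\<exists>r. cub a b c ((dbl a b c ^^ n) x) = r\<^sup>2 * cub a b c x)"
  using assms
proof (induction n)
  case 0
  show ?case by (auto intro: exI[of _ 1])
next
  case (Suc n)
  obtain P Q where PQ: "dbl_poly a b c n = (P, Q)" by fastforce
  define p q where "p = poly P x" and "q = poly Q x"
  have q: "q \<noteq> 0" using Suc.prems[of n] by (simp add: PQ q_def)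
  \<comment> \<open>This form is \<open>q ^ 3\<close> times the value of \<open>cub\<close> at the
    iterate \<open>p / q\<close> and divides the next denominator, so the iterate is not a root and
    can be doubled.\<close>
  have m: "p ^ 3 + a * (p\<^sup>2 * q) + b * (p * q\<^sup>2) + c * q ^ 3 \<noteq> 0"
    using Suc.prems[of "Suc n"] by (simp add: PQ p_def q_def)
  have IH: "(dbl a b c ^^ n) x = p / q" "\<exists>r. cub a b c ((dbl a b c ^^ n) x) = r\<^sup>2 * cub a b c x"
    using Suc by (auto simp: PQ p_def q_def)
  have "cub a b c (p / q) \<noteq> 0" using m q by (simp add: cub_divide)
  from cub_dbl[OF this] IH(1) obtain r where
    r: "cub a b c ((dbl a b c ^^ Suc n) x) = r\<^sup>2 * cub a b c ((dbl a b c ^^ n) x)" by auto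
  from IH(2) obtain s where "cub a b c ((dbl a b c ^^ n) x) = s\<^sup>2 * cub a b c x" by auto
  with r have "cub a b c ((dbl a b c ^^ Suc n) x) = r\<^sup>2 * (s\<^sup>2 * cub a b c x)" by simp
  hence "\<exists>r. cub a b c ((dbl a b c ^^ Suc n) x) = r\<^sup>2 * cub a b c x"
    by (intro exI[of _ "r * s"]) (simp add: power_mult_distrib)
  moreover have "(dbl a b c ^^ Suc n) x =
      poly (fst (dbl_poly a b c (Suc n))) x / poly (snd (dbl_poly a b c (Suc n))) x"
    using IH(1) dbl_divide[OF q m] by (simp add: PQ p_def q_def)
  ultimately show ?case by blast
qed

text \<open>Distinct iterates are rational functions with different growth at infinity, so they
  agree only finitely often; the denominators also have finitely many zeros.\<close>

lemma finite_dbl_exceptions: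
  fixes a :: "'a::field_char_0"
  shows "finite {x. \<not> (inj_on (\<lambda>i. (dbl a b c ^^ i) x) {..n} \<and>
    (\<forall>i\<le>n. \<exists>r. cub a b c ((dbl a b c ^^ i) x) = r\<^sup>2 * cub a b c x))}"
proof -
  define P Q where "P i = fst (dbl_poly a b c i)" and "Q i = snd (dbl_poly a b c i)" for i
  define R where "R i j = P i * Q j - P j * Q i" for i j
  have top: "\<exists>d \<alpha>. \<alpha> \<noteq> 0 \<and> top_coeff (P i) (Suc d) \<alpha> \<and> top_coeff (Q i) d (4 ^ i * \<alpha>)" for i
    using dbl_poly_top unfolding P_def Q_def .
  have "Q i \<noteq> 0" for i using top[of i] by (auto simp: top_coeff_def)
  hence f1: "finite (\<Union>i\<le>n. {x. poly (Q i) x = 0})" by (auto intro: poly_roots_finite)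
  have "R i j \<noteq> 0" if "i \<noteq> j" for i j
  proof -
    obtain d \<alpha> where 1: "\<alpha> \<noteq> 0" "top_coeff (P i) (Suc d) \<alpha>" "top_coeff (Q i) d (4 ^ i * \<alpha>)"
      using top by blast
    obtain e \<beta> where 2: "\<beta> \<noteq> 0" "top_coeff (P j) (Suc e) \<beta>" "top_coeff (Q j) e (4 ^ j * \<beta>)"
      using top by blast
    have "top_coeff (R i j) (Suc (d + e)) (\<alpha> * (4 ^ j * \<beta>) - \<beta> * (4 ^ i * \<alpha>))"
      unfolding R_def using top_coeff_mult[OF 1(2) 2(3)] top_coeff_mult[OF 2(2) 1(3)]
      by (intro top_coeff_diff) (simp_all add: add.commute)
    hence "coeff (R i j) (Suc (d + e)) = \<alpha> * \<beta> * (4 ^ j - 4 ^ i)"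
      by (simp add: top_coeff_def algebra_simps)
    moreover have "(4 :: 'a) ^ j \<noteq> 4 ^ i"
    proof
      assume "(4 :: 'a) ^ j = 4 ^ i"
      hence "of_nat (4 ^ j) = (of_nat (4 ^ i) :: 'a)" by simp
      hence "(4 :: nat) ^ j = 4 ^ i" by (simp only: of_nat_eq_iff)
      thus False using that by simp
    qed
    ultimately show ?thesis using 1 2 by auto
  qed
  hence f2: "finite (\<Union>i\<le>n. \<Union>j\<in>{..n} - {i}. {x. poly (R i j) x = 0})"
    by (auto intro: poly_roots_finite)
  have "{x. \<not> (inj_on (\<lambda>i. (dbl a b c ^^ i) x) {..n} \<and>
      (\<forall>i\<le>n. \<exists>r. cub a b c ((dbl a b c ^^ i) x) = r\<^sup>2 * cub a b c x))} \<subseteq>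
    (\<Union>i\<le>n. {x. poly (Q i) x = 0}) \<union> (\<Union>i\<le>n. \<Union>j\<in>{..n} - {i}. {x. poly (R i j) x = 0})"
    (is "?B \<subseteq> ?C")
  proof
    fix x assume x: "x \<in> ?B"
    show "x \<in> ?C"
    proof (rule ccontr)
      assume nC: "x \<notin> ?C"
      hence nz: "poly (Q i) x \<noteq> 0" if "i \<le> n" for i using that by auto
      have it: "(dbl a b c ^^ i) x = poly (P i) x / poly (Q i) x"
        "\<exists>r. cub a b c ((dbl a b c ^^ i) x) = r\<^sup>2 * cub a b c x" if "i \<le> n" for i
        using dbl_iterate[of i a b c x] nz that unfolding P_def Q_def by auto
      have "inj_on (\<lambda>i. (dbl a b c ^^ i) x) {..n}"
      proof (rule inj_onI, rule ccontr)
        fix i j assume ij: "i \<in> {..n}" "j \<in> {..n}" "(dbl a b c ^^ i) x = (dbl a b c ^^ j) x" "i \<noteq> j"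
        hence "poly (R i j) x = 0" using it(1)[of i] it(1)[of j] nz[of i] nz[of j]
          by (simp add: R_def field_simps)
        thus False using nC ij by auto
      qed
      thus False using x it(2) by blast
    qed
  qed
  thus ?thesis using f1 f2 finite_subset by blast
qed

section \<open>Points over quadratic extensions\<close>

definition is_sq :: "'a::field \<Rightarrow> bool"
  where "is_sq x \<longleftrightarrow> (\<exists>r. x = r\<^sup>2)"

text \<open>\<open>p\<close> and \<open>q\<close> acquire square roots in a common quadratic extension, but not already in the field.\<close>

definition sq_in_quadratic :: "'a::field \<Rightarrow> 'a \<Rightarrow> bool"
  where "sq_in_quadratic p q \<longleftrightarrow> (\<exists>D. \<not> is_sq D \<and> (\<exists>r. p = r\<^sup>2 \<or> p = r\<^sup>2 * D) \<and>
    (\<exists>r. q = r\<^sup>2 \<or> q = r\<^sup>2 * D) \<and> \<not> (is_sq p \<and> is_sq q))"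

lemma infinite_image_finite_fibres:
  assumes "infinite A" "\<And>y. finite {x. h x = y}"
  shows "infinite (h ` A)"
proof
  assume "finite (h ` A)"
  from inf_img_fin_domE'[OF this assms(1)] obtain y where y: "infinite (h -` {y} \<inter> A)" by blast
  have "finite (h -` {y} \<inter> A)" by (rule finite_subset[OF _ assms(2)[of y]]) auto
  with y show False by simp
qed

lemma finite_vimage_finite_fibres:
  assumes "finite B" "\<And>y. finite {x. h x = y}"
  shows "finite {x. h x \<in> B}"
proof -
  have "{x. h x \<in> B} = (\<Union>y\<in>B. {x. h x = y})" by auto
  thus ?thesis using assms by auto
qed

lemma finite_square_roots: "finite {t :: 'a::field. t\<^sup>2 = D}"
proof -
  have "{t. t\<^sup>2 = D} \<subseteq> {t. poly [:-D, 0, 1:] t = 0}" by (auto simp: power2_eq_square)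
  thus ?thesis using poly_roots_finite by (rule finite_subset) simp
qed

lemma finite_cub_roots: "finite {x. cub a b c x = 0}"
proof -
  have "{x. cub a b c x = 0} \<subseteq> {x. poly [:c, b, a, 1:] x = 0}"
    by (auto simp: cub_def algebra_simps power2_eq_square power3_eq_cube)
  thus ?thesis using poly_roots_finite by (rule finite_subset) simp
qed

text \<open>The products of one nonsquare with nonzero squares already suffice.\<close>

lemma infinite_nonsquares:
  assumes "\<not> is_sq (D :: 'a::field_char_0)"
  shows "infinite {D :: 'a. \<not> is_sq D}"
proof -
  have "is_sq (0 :: 'a)" unfolding is_sq_def by (rule exI[of _ 0]) simp
  hence D: "D \<noteq> 0" using assms by metis
  have "\<not> is_sq (D * r\<^sup>2)" if "r \<noteq> 0" for r
  proof
    assume "is_sq (D * r\<^sup>2)"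
    then obtain s where "D * r\<^sup>2 = s\<^sup>2" by (auto simp: is_sq_def)
    hence "D = (s / r)\<^sup>2" using that by (simp add: field_simps)
    thus False using assms by (auto simp: is_sq_def)
  qed
  hence sub: "(\<lambda>r. D * r\<^sup>2) ` (UNIV - {0}) \<subseteq> {D. \<not> is_sq D}" by auto
  have fib: "finite {r. D * r\<^sup>2 = y}" for y
  proof -
    have "{r. D * r\<^sup>2 = y} = {r. r\<^sup>2 = y / D}" using D by (simp add: eq_divide_eq mult.commute)
    thus ?thesis by (simp only: finite_square_roots)
  qed
  have "infinite ((\<lambda>r. D * r\<^sup>2) ` (UNIV - {0 :: 'a}))"
    by (intro infinite_image_finite_fibres fib) (simp add: infinite_UNIV_char_0)
  thus ?thesis using sub finite_subset by blast
qed

text \<open>If \<open>f (\<xi> (t\<^sup>2))\<close> is a nonsquare \<open>c\<close> for infinitely many \<open>t\<close>, then over \<open>k(\<surd>c)\<close> both curves carry a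
  point, and the first one can be doubled repeatedly. Otherwise both curves have infinitely many
  rational points, and for nonsquare \<open>D\<close> one of \<open>f (\<xi> D)\<close>, \<open>g (\<eta> D)\<close> is a nonsquare.\<close>

lemma infinite_quadratic_pairs:
  fixes \<xi> \<eta> :: "'k::field_char_0 \<Rightarrow> 'k"
  assumes D0: "\<not> is_sq (D0 :: 'k)"
    and twist: "finite {D. D ^ 3 * cub a b c (\<xi> D) \<noteq> cub a' b' c' (\<eta> D)}"
    and fX: "\<And>y. finite {D. \<xi> D = y}" and fU: "\<And>y. finite {D. \<eta> D = y}"
  shows "infinite {u. \<exists>S. finite S \<and> card S \<ge> N \<and>
    (\<forall>x\<in>S. sq_in_quadratic (cub a b c x) (cub a' b' c' u))}"
proof -
  define f g where "f = cub a b c" and "g = cub a' b' c'"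
  define B where "B = {x. \<not> (inj_on (\<lambda>i. (dbl a b c ^^ i) x) {..N} \<and>
    (\<forall>i\<le>N. \<exists>r. f ((dbl a b c ^^ i) x) = r\<^sup>2 * f x))}"
  have "finite B" unfolding B_def f_def by (rule finite_dbl_exceptions)
  \<comment> \<open>Discarded parameters: the twist identity fails, doubling misbehaves at the
    abscissa, the cubic vanishes there, or \<open>D = 0\<close>.\<close>
  define bad where "bad = {D. D ^ 3 * f (\<xi> D) \<noteq> g (\<eta> D)} \<union> {D. \<xi> D \<in> B} \<union>
    {D. \<xi> D \<in> {x. f x = 0}} \<union> {0}"
  have bad: "finite bad" unfolding bad_def
    using twist finite_cub_roots \<open>finite B\<close> fX
    by (intro finite_UnI finite_vimage_finite_fibres) (auto simp: f_def g_def)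
  have bad2: "finite {t. t\<^sup>2 \<in> bad}"
    by (intro finite_vimage_finite_fibres bad finite_square_roots)
  have fX2: "finite {t. \<xi> (t\<^sup>2) = y}" and fU2: "finite {t. \<eta> (t\<^sup>2) = y}" for y
    using finite_vimage_finite_fibres[OF fX[of y] finite_square_roots]
      finite_vimage_finite_fibres[OF fU[of y] finite_square_roots] by simp_all
  define G where "G = {u. \<exists>S. finite S \<and> card S \<ge> N \<and> (\<forall>x\<in>S. sq_in_quadratic (f x) (g u))}"
  define T where "T = {t. \<not> is_sq (f (\<xi> (t\<^sup>2)))}"
  have "infinite G"
  proof (cases "infinite T")
    case True
    hence "infinite (T - {t. t\<^sup>2 \<in> bad})" using bad2 by (rule Diff_infinite_finite[rotated])
    hence inf: "infinite ((\<lambda>t. \<eta> (t\<^sup>2)) ` (T - {t. t\<^sup>2 \<in> bad}))"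
      by (rule infinite_image_finite_fibres[OF _ fU2])
    have "\<eta> (t\<^sup>2) \<in> G" if t: "t \<in> T" "t\<^sup>2 \<notin> bad" for t
    proof -
      define x where "x = \<xi> (t\<^sup>2)"
      define S where "S = (\<lambda>i. (dbl a b c ^^ i) x) ` {..N}"
      have x: "\<not> is_sq (f x)" "x \<notin> B" and t0: "t \<noteq> 0" and gU: "g (\<eta> (t\<^sup>2)) = (t ^ 3)\<^sup>2 * f x"
        using t unfolding T_def bad_def x_def by (auto simp: power_mult[symmetric] mult.commute)
      have S: "finite S" "card S \<ge> N"
        using x(2) by (auto simp: S_def B_def card_image)
      have nsq: "\<not> is_sq (g (\<eta> (t\<^sup>2)))"
      proof
        assume "is_sq (g (\<eta> (t\<^sup>2)))"
        then obtain s where "(t ^ 3)\<^sup>2 * f x = s\<^sup>2" by (auto simp: is_sq_def gU)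
        hence "f x = s\<^sup>2 / (t ^ 3)\<^sup>2" using t0 by (simp add: eq_divide_eq mult.commute)
        hence "f x = (s / t ^ 3)\<^sup>2" by (simp only: power_divide)
        thus False using x by (auto simp: is_sq_def)
      qed
      \<comment> \<open>The field generated by a square root of \<open>f x\<close> serves all
        doubles of \<open>x\<close> and the second curve at once.\<close>
      have "sq_in_quadratic (f y) (g (\<eta> (t\<^sup>2)))" if "y \<in> S" for y
        unfolding sq_in_quadratic_def
      proof (rule exI[of _ "f x"], intro conjI)
        show "\<exists>r. f y = r\<^sup>2 \<or> f y = r\<^sup>2 * f x" using that x by (auto simp: S_def B_def)
        show "\<exists>r. g (\<eta> (t\<^sup>2)) = r\<^sup>2 \<or> g (\<eta> (t\<^sup>2)) = r\<^sup>2 * f x" using gU by blast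
      qed (use x nsq in auto)
      thus ?thesis using S unfolding G_def by blast
    qed
    hence "(\<lambda>t. \<eta> (t\<^sup>2)) ` (T - {t. t\<^sup>2 \<in> bad}) \<subseteq> G" by auto
    thus ?thesis using inf finite_subset by blast
  next
    case False
    hence "finite (T \<union> {t. t\<^sup>2 \<in> bad})" using bad2 by simp
    hence inf: "infinite (UNIV - (T \<union> {t. t\<^sup>2 \<in> bad}))"
      using infinite_UNIV_char_0 by (rule Diff_infinite_finite)
    \<comment> \<open>The value of \<open>g\<close> is \<open>(t ^ 3)\<^sup>2\<close> times that of
      \<open>f\<close>, so rational points on the first curve come with rational points on the
      second.\<close>
    have sq: "is_sq (f (\<xi> (t\<^sup>2)))" "is_sq (g (\<eta> (t\<^sup>2)))" if "t \<in> UNIV - (T \<union> {t. t\<^sup>2 \<in> bad})" for t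
    proof -
      from that show 1: "is_sq (f (\<xi> (t\<^sup>2)))" by (simp add: T_def)
      have "g (\<eta> (t\<^sup>2)) = (t ^ 3)\<^sup>2 * f (\<xi> (t\<^sup>2))"
        using that by (auto simp: bad_def power_mult[symmetric] mult.commute)
      moreover obtain r where "f (\<xi> (t\<^sup>2)) = r\<^sup>2" using 1 by (auto simp: is_sq_def)
      ultimately have "g (\<eta> (t\<^sup>2)) = (t ^ 3 * r)\<^sup>2" by (simp add: power_mult_distrib)
      thus "is_sq (g (\<eta> (t\<^sup>2)))" unfolding is_sq_def by blast
    qed
    have Xs: "infinite {x. is_sq (f x)}"
      by (rule infinite_super[OF _ infinite_image_finite_fibres[OF inf fX2]]) (use sq(1) in blast)
    have Us: "infinite {u. is_sq (g u)}"
      by (rule infinite_super[OF _ infinite_image_finite_fibres[OF inf fU2]]) (use sq(2) in blast)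
    have "infinite ({D. \<not> is_sq D} - bad)"
      using bad infinite_nonsquares[OF D0] by (rule Diff_infinite_finite)
    \<comment> \<open>For \<open>D \<noteq> 0\<close> the factor \<open>D ^ 3\<close> is
      \<open>D\<close> times a nonzero square, so two nonzero square values would make
      \<open>D\<close> a square.\<close>
    moreover have "\<not> is_sq (f (\<xi> D)) \<or> \<not> is_sq (g (\<eta> D))" if "D \<in> {D. \<not> is_sq D} - bad" for D
    proof (rule ccontr)
      assume "\<not> ?thesis"
      then obtain r s where rs: "f (\<xi> D) = r\<^sup>2" "g (\<eta> D) = s\<^sup>2" by (auto simp: is_sq_def)
      have *: "D \<noteq> 0" "f (\<xi> D) \<noteq> 0" "D ^ 3 * f (\<xi> D) = g (\<eta> D)" using that by (auto simp: bad_def)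
      have r: "D * r \<noteq> 0" using * rs by auto
      have "D * (D * r)\<^sup>2 = s\<^sup>2"
        using *(3) unfolding rs by (simp add: power2_eq_square power3_eq_cube mult_ac)
      hence "D = s\<^sup>2 / (D * r)\<^sup>2" using r by (simp add: eq_divide_eq)
      hence "D = (s / (D * r))\<^sup>2" by (simp only: power_divide)
      thus False using that unfolding is_sq_def by blast
    qed
    hence "{D. \<not> is_sq D} - bad \<subseteq> {D. \<xi> D \<in> {x. \<not> is_sq (f x)}} \<union> {D. \<eta> D \<in> {u. \<not> is_sq (g u)}}"
      by auto
    ultimately have "infinite {D. \<xi> D \<in> {x. \<not> is_sq (f x)}} \<or> infinite {D. \<eta> D \<in> {u. \<not> is_sq (g u)}}"
      by (auto dest: finite_subset simp del: mem_Collect_eq)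
    hence "infinite {x. \<not> is_sq (f x)} \<or> infinite {u. \<not> is_sq (g u)}"
      using finite_vimage_finite_fibres[OF _ fX, of "{x. \<not> is_sq (f x)}"]
        finite_vimage_finite_fibres[OF _ fU, of "{u. \<not> is_sq (g u)}"] by (auto simp del: mem_Collect_eq)
    thus ?thesis
    proof
      \<comment> \<open>Fixed quadratic abscissae on the first curve are paired with all rational
        abscissae of the second; each pair uses its own quadratic field. The other case exchanges
        the roles.\<close>
      assume "infinite {x. \<not> is_sq (f x)}"
      then obtain S where S: "finite S" "card S = N" "S \<subseteq> {x. \<not> is_sq (f x)}"
        using infinite_arbitrarily_large by blast
      have "sq_in_quadratic (f x) (g u)" if "x \<in> S" "is_sq (g u)" for x u
        unfolding sq_in_quadratic_def
      proof (rule exI[of _ "f x"], intro conjI)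
        show "\<exists>r. f x = r\<^sup>2 \<or> f x = r\<^sup>2 * f x" by (intro exI[of _ 1]) simp
      qed (use that S in \<open>auto simp: is_sq_def\<close>)
      hence "{u. is_sq (g u)} \<subseteq> G" using S unfolding G_def by (auto intro!: exI[of _ S])
      thus ?thesis using Us finite_subset by blast
    next
      assume inf: "infinite {u. \<not> is_sq (g u)}"
      obtain S where S: "finite S" "card S = N" "S \<subseteq> {x. is_sq (f x)}"
        using Xs infinite_arbitrarily_large by blast
      have "sq_in_quadratic (f x) (g u)" if "x \<in> S" "\<not> is_sq (g u)" for x u
        unfolding sq_in_quadratic_def
      proof (rule exI[of _ "g u"], intro conjI)
        show "\<exists>r. g u = r\<^sup>2 \<or> g u = r\<^sup>2 * g u" by (intro exI[of _ 1]) simp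
      qed (use that S in \<open>auto simp: is_sq_def\<close>)
      hence "{u. \<not> is_sq (g u)} \<subseteq> G" using S unfolding G_def by (auto intro!: exI[of _ S])
      thus ?thesis using inf finite_subset by blast
    qed
  qed
  thus ?thesis unfolding G_def f_def g_def .
qed

unbundle no fps_syntax

section \<open>Density\<close>

text \<open>On \<open>w\<^sup>2 = f x\<close> the functions \<open>x\<close> and \<open>w\<close> have poles of order 2 and 3 at infinity. The weight of a
  polynomial in \<open>x\<close> is its pole order; weights are integers, so that a negative weight forces the
  polynomial to vanish.\<close>

definition weight_le :: "'a::zero poly \<Rightarrow> int \<Rightarrow> bool"
  where "weight_le p m \<longleftrightarrow> (\<forall>i. m < 2 * int i \<longrightarrow> coeff p i = 0)"

text \<open>No monomial in \<open>x\<close> has odd or negative weight, hence the value 0.\<close>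

definition weight_coeff :: "'a::zero poly \<Rightarrow> int \<Rightarrow> 'a"
  where "weight_coeff p m = (if even m \<and> 0 \<le> m then coeff p (nat (m div 2)) else 0)"

lemma weight_le_add: "weight_le p m \<Longrightarrow> weight_le q m \<Longrightarrow> weight_le (p + q) m"
  for p q :: "'a::comm_ring_1 poly"
  by (auto simp: weight_le_def)

lemma weight_coeff_add: "weight_coeff (p + q) m = weight_coeff p m + weight_coeff q m"
  for p q :: "'a::comm_ring_1 poly"
  by (auto simp: weight_coeff_def)

lemma weight_le_mult:
  fixes p q :: "'a::comm_ring_1 poly"
  assumes "weight_le p m" "weight_le q n"
  shows "weight_le (p * q) (m + n)"
  unfolding weight_le_def coeff_mult
proof (intro allI impI sum.neutral ballI)
  fix k i assume k: "m + n < 2 * int k" and i: "i \<in> {..k}"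
  hence "m < 2 * int i \<or> n < 2 * int (k - i)" by auto
  thus "coeff p i * coeff q (k - i) = 0" using assms unfolding weight_le_def by auto
qed

text \<open>Only the product of the two top terms reaches weight \<open>m + n\<close>. If both
  weights are odd or one is negative, there is no such product and both sides vanish.\<close>

lemma weight_coeff_mult:
  fixes p q :: "'a::comm_ring_1 poly"
  assumes "weight_le p m" "weight_le q n"
  shows "weight_coeff (p * q) (m + n) = weight_coeff p m * weight_coeff q n"
proof (cases "even (m + n) \<and> 0 \<le> m + n")
  case False
  thus ?thesis by (auto simp: weight_coeff_def)
next
  case True
  then obtain k where k: "m + n = 2 * int k" by (metis evenE nonneg_int_cases zero_le_mult_iff
    zero_less_numeral less_le_not_le)
  have zero: "coeff p i * coeff q (k - i) = 0" if "i \<le> k" "2 * int i \<noteq> m" for i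
  proof -
    have "m < 2 * int i \<or> n < 2 * int (k - i)" using that k by auto
    thus ?thesis using assms unfolding weight_le_def by auto
  qed
  have lhs: "weight_coeff (p * q) (m + n) = (\<Sum>i\<le>k. coeff p i * coeff q (k - i))"
    by (simp add: weight_coeff_def k coeff_mult)
  show ?thesis
  proof (cases "even m \<and> 0 \<le> m \<and> 0 \<le> n")
    case True
    define j where "j = nat (m div 2)"
    have j: "m = 2 * int j" "n = 2 * int (k - j)" "j \<le> k" using True k by (auto simp: j_def)
    have "(\<Sum>i\<le>k. coeff p i * coeff q (k - i)) = (\<Sum>i\<in>{j}. coeff p i * coeff q (k - i))"
      by (rule sum.mono_neutral_right) (use j zero in auto)
    thus ?thesis unfolding lhs using j by (simp add: weight_coeff_def del: of_nat_diff)
  next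
    case False
    have "coeff p i * coeff q (k - i) = 0" if i: "i \<le> k" for i
    proof (cases "2 * int i = m")
      case True
      hence "n < 0" using False by auto
      thus ?thesis using assms(2) by (simp add: weight_le_def)
    qed (use zero i in blast)
    hence "(\<Sum>i\<le>k. coeff p i * coeff q (k - i)) = 0" by (intro sum.neutral) auto
    moreover have "weight_coeff p m * weight_coeff q n = 0"
      using False by (auto simp: weight_coeff_def)
    ultimately show ?thesis unfolding lhs by simp
  qed
qed

section \<open>Completing the square in the Weierstrass equation\<close>

definition weierstrass_cubic :: "'a::field weierstrass \<Rightarrow> 'a poly"
  where "weierstrass_cubic E = [:b6 E / 4, b4 E / 2, b2 E / 4, 1:]"

definition half_line :: "'a::field weierstrass \<Rightarrow> 'a \<Rightarrow> 'a"
  where "half_line E x = (a\<^sub>1 E * x + a\<^sub>3 E) / 2"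

lemma poly_weierstrass_cubic:
  "poly (weierstrass_cubic E) x = cub (b2 E / 4) (b4 E / 2) (b6 E / 4) x"
  by (simp add: weierstrass_cubic_def cub_def algebra_simps power2_eq_square power3_eq_cube)

lemma on_curve_iff_square:
  fixes E :: "'a::field_char_0 weierstrass"
  shows "on_curve E (Affine x y) \<longleftrightarrow> (y + half_line E x)\<^sup>2 = poly (weierstrass_cubic E) x"
proof -
  have "(y + half_line E x)\<^sup>2 - poly (weierstrass_cubic E) x =
    y\<^sup>2 + a\<^sub>1 E * x * y + a\<^sub>3 E * y - (x ^ 3 + a\<^sub>2 E * x\<^sup>2 + a\<^sub>4 E * x + a\<^sub>6 E)"
    unfolding poly_weierstrass_cubic half_line_def cub_def b2_def b4_def b6_def
    by (simp add: field_simps power2_eq_square power3_eq_cube)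
  thus ?thesis by (metis on_curve.simps(2) eq_iff_diff_eq_0)
qed

lemma weight_cubic: "weight_le (weierstrass_cubic E) 6" "weight_coeff (weierstrass_cubic E) 6 = 1"
  by (auto simp: weight_le_def weight_coeff_def weierstrass_cubic_def coeff_pCons
    numeral_eq_Suc split: nat.splits)

text \<open>Functions on the curve which are homogeneous polynomials of degree \<open>d\<close> in the projective
  coordinates, written as \<open>A x + w * B x\<close>.\<close>

definition regular :: "'a::field weierstrass \<Rightarrow> nat \<Rightarrow> ('a ec_point \<Rightarrow> 'a) \<Rightarrow> bool"
  where "regular E d h \<longleftrightarrow> (\<exists>A B. weight_le A (3 * int d) \<and> weight_le B (3 * int d - 3) \<and>
    (\<forall>x y. on_curve E (Affine x y) \<longrightarrow> h (Affine x y) = poly A x + (y + half_line E x) * poly B x) \<and>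
    h Infinity = weight_coeff A (3 * int d) + weight_coeff B (3 * int d - 3))"

lemma regular_add: "regular E d h \<Longrightarrow> regular E d k \<Longrightarrow> regular E d (\<lambda>P. h P + k P)"
  for E :: "'a::field_char_0 weierstrass"
  unfolding regular_def
  apply (elim exE conjE)
  subgoal for A C B D
    by (rule exI[of _ "A + C"], rule exI[of _ "B + D"])
      (auto simp: weight_le_add weight_coeff_add algebra_simps)
  done

text \<open>Replacing \<open>w * w\<close> by the cubic \<open>f\<close>, monic of weight 6,
  restores the normal form and adds the bounds. The value at infinity is the coefficient at pole
  order \<open>3 * d\<close>, where \<open>w\<close> contributes 3; the two summands have weights of
  opposite parity.\<close>

lemma regular_mult:
  fixes E :: "'a::field_char_0 weierstrass"
  assumes "regular E d h" "regular E e k"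
  shows "regular E (d + e) (\<lambda>P. h P * k P)"
proof -
  define f where "f = weierstrass_cubic E"
  obtain A B where AB: "weight_le A (3 * int d)" "weight_le B (3 * int d - 3)"
    "\<And>x y. on_curve E (Affine x y) \<Longrightarrow> h (Affine x y) = poly A x + (y + half_line E x) * poly B x"
    "h Infinity = weight_coeff A (3 * int d) + weight_coeff B (3 * int d - 3)"
    using assms(1) unfolding regular_def by blast
  obtain C D where CD: "weight_le C (3 * int e)" "weight_le D (3 * int e - 3)"
    "\<And>x y. on_curve E (Affine x y) \<Longrightarrow> k (Affine x y) = poly C x + (y + half_line E x) * poly D x"
    "k Infinity = weight_coeff C (3 * int e) + weight_coeff D (3 * int e - 3)"
    using assms(2) unfolding regular_def by blast
  have i: "3 * int (d + e) = 3 * int d + 3 * int e"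
    "3 * int (d + e) = 6 + ((3 * int d - 3) + (3 * int e - 3))"
    "3 * int (d + e) - 3 = 3 * int d + (3 * int e - 3)"
    "3 * int (d + e) - 3 = (3 * int d - 3) + 3 * int e" by auto
  have BD: "weight_le (B * D) ((3 * int d - 3) + (3 * int e - 3))"
    by (intro weight_le_mult AB CD)
  show ?thesis unfolding regular_def
  proof (intro exI conjI allI impI)
    show "weight_le (A * C + f * (B * D)) (3 * int (d + e))"
      by (rule weight_le_add, unfold i(1), intro weight_le_mult AB CD, fold i(1), unfold i(2),
        unfold f_def, intro weight_le_mult weight_cubic AB CD)
    show "weight_le (A * D + B * C) (3 * int (d + e) - 3)"
      by (rule weight_le_add, unfold i(3), intro weight_le_mult AB CD, fold i(3), unfold i(4),
        intro weight_le_mult AB CD)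
    have "weight_coeff (A * C) (3 * int (d + e)) = weight_coeff A (3 * int d) * weight_coeff C (3 * int e)"
      unfolding i(1) by (intro weight_coeff_mult AB CD)
    moreover have "weight_coeff (f * (B * D)) (3 * int (d + e)) =
        weight_coeff B (3 * int d - 3) * weight_coeff D (3 * int e - 3)"
      unfolding i(2) f_def weight_coeff_mult[OF weight_cubic(1) BD] weight_cubic(2)
        weight_coeff_mult[OF AB(2) CD(2)] by simp
    moreover have "weight_coeff (A * D) (3 * int (d + e) - 3) =
        weight_coeff A (3 * int d) * weight_coeff D (3 * int e - 3)"
      unfolding i(3) by (intro weight_coeff_mult AB CD)
    moreover have "weight_coeff (B * C) (3 * int (d + e) - 3) =
        weight_coeff B (3 * int d - 3) * weight_coeff C (3 * int e)"
      unfolding i(4) by (intro weight_coeff_mult AB CD)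
    ultimately show "h Infinity * k Infinity =
        weight_coeff (A * C + f * (B * D)) (3 * int (d + e)) +
        weight_coeff (A * D + B * C) (3 * int (d + e) - 3)"
      unfolding AB(4) CD(4) weight_coeff_add by (simp add: algebra_simps)
  next
    fix x y assume on: "on_curve E (Affine x y)"
    define w where "w = y + half_line E x"
    have w: "w * w = poly f x"
      using on unfolding on_curve_iff_square w_def f_def power2_eq_square .
    show "h (Affine x y) * k (Affine x y) =
       poly (A * C + f * (B * D)) x + (y + half_line E x) * poly (A * D + B * C) x"
      unfolding AB(3)[OF on] CD(3)[OF on] w_def[symmetric] poly_add poly_mult w[symmetric]
      by (simp add: algebra_simps)
  qed
qed

lemma regular_const: "regular E 0 (\<lambda>P. c)" for E :: "'a::field_char_0 weierstrass"
  unfolding regular_def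
  by (rule exI[of _ "[:c:]"], rule exI[of _ 0])
    (auto simp: weight_le_def weight_coeff_def coeff_pCons split: nat.splits)

lemma regular_coords: "regular E 1 (\<lambda>P. homogeneous_coords P $ i)"
  for E :: "'a::field_char_0 weierstrass"
proof -
  have "i = 1 \<or> i = 2 \<or> i = 3" using exhaust_3 by blast
  moreover have "regular E 1 (\<lambda>P. homogeneous_coords P $ 1)" unfolding regular_def
    by (rule exI[of _ "[:0, 1:]"], rule exI[of _ 0])
      (auto simp: weight_le_def weight_coeff_def coeff_pCons split: nat.splits)
  \<comment> \<open>Here \<open>y\<close> is \<open>w\<close> minus \<open>half_line E x\<close>;
    the value 1 at infinity comes from the coefficient of \<open>w\<close>.\<close>
  moreover have "regular E 1 (\<lambda>P. homogeneous_coords P $ 2)" unfolding regular_def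
    by (rule exI[of _ "[:- (a\<^sub>3 E / 2), - (a\<^sub>1 E / 2):]"], rule exI[of _ 1])
      (auto simp: weight_le_def weight_coeff_def coeff_pCons half_line_def field_simps split: nat.splits)
  moreover have "regular E 1 (\<lambda>P. homogeneous_coords P $ 3)" unfolding regular_def
    by (rule exI[of _ 1], rule exI[of _ 0])
      (auto simp: weight_le_def weight_coeff_def)
  ultimately show ?thesis by blast
qed

lemma regular_power: "regular E d h \<Longrightarrow> regular E (n * d) (\<lambda>P. h P ^ n)"
  for E :: "'a::field_char_0 weierstrass"
proof (induction n)
  case 0
  show ?case using regular_const[of E 1] by simp
next
  case (Suc n)
  from regular_mult[OF Suc.prems Suc.IH[OF Suc.prems]] show ?case by simp
qed

lemma regular_prod:
  fixes E :: "'a::field_char_0 weierstrass"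
  assumes "finite I" "\<And>i. i \<in> I \<Longrightarrow> regular E (d i) (h i)"
  shows "regular E (\<Sum>i\<in>I. d i) (\<lambda>P. \<Prod>i\<in>I. h i P)"
  using assms
proof (induction I)
  case empty
  show ?case using regular_const[of E 1] by simp
next
  case (insert i I)
  from regular_mult[OF insert.prems[of i] insert.IH] insert show ?case by simp
qed

lemma regular_zero: "regular E d (\<lambda>P. 0)" for E :: "'a::field_char_0 weierstrass"
  unfolding regular_def
  by (rule exI[of _ 0], rule exI[of _ 0]) (auto simp: weight_le_def weight_coeff_def)

lemma regular_sum:
  fixes E :: "'a::field_char_0 weierstrass"
  assumes "finite I" "\<And>i. i \<in> I \<Longrightarrow> regular E d (h i)"
  shows "regular E d (\<lambda>P. \<Sum>i\<in>I. h i P)"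
  using assms by (induction I) (auto intro: regular_add regular_zero)

lemma regular_monomial_sum:
  fixes E :: "'a::field_char_0 weierstrass" and e :: "'m \<Rightarrow> 3 \<Rightarrow> nat"
  assumes "finite M" "\<And>m. m \<in> M \<Longrightarrow> (\<Sum>i\<in>UNIV. e m i) = d"
  shows "regular E d (\<lambda>P. \<Sum>m\<in>M. c m * (\<Prod>i\<in>UNIV. homogeneous_coords P $ i ^ e m i))"
proof (rule regular_sum[OF assms(1)])
  fix m assume m: "m \<in> M"
  have "regular E (\<Sum>i\<in>UNIV. e m i * 1) (\<lambda>P. \<Prod>i\<in>UNIV. homogeneous_coords P $ i ^ e m i)"
    by (intro regular_prod regular_power regular_coords) auto
  from regular_mult[OF regular_const this] assms(2)[OF m]
  show "regular E d (\<lambda>P. c m * (\<Prod>i\<in>UNIV. homogeneous_coords P $ i ^ e m i))" by simp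
qed

text \<open>The zeros of \<open>A + w * B\<close> are among those of its norm \<open>A\<^sup>2 - f * B\<^sup>2\<close>, which for parity reasons
  vanishes only if \<open>A = B = 0\<close>.\<close>

lemma regular_zeros:
  fixes E :: "'a::field_char_0 weierstrass"
  assumes "regular E d h" and P0: "on_curve E P0" "h P0 \<noteq> 0"
  shows "finite {x. \<exists>y. on_curve E (Affine x y) \<and> h (Affine x y) = 0}" (is "finite ?Z")
    and "card {x. \<exists>y. on_curve E (Affine x y) \<and> h (Affine x y) = 0} \<le> 3 * d"
proof -
  define f where "f = weierstrass_cubic E"
  obtain A B where AB: "weight_le A (3 * int d)" "weight_le B (3 * int d - 3)"
    "\<And>x y. on_curve E (Affine x y) \<Longrightarrow> h (Affine x y) = poly A x + (y + half_line E x) * poly B x"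
    "h Infinity = weight_coeff A (3 * int d) + weight_coeff B (3 * int d - 3)"
    using assms(1) unfolding regular_def by blast
  define N where "N = A * A - f * (B * B)"
  have degf: "degree f = 3" "f \<noteq> 0" by (simp_all add: f_def weierstrass_cubic_def)
  have "N \<noteq> 0"
  proof
    assume "N = 0"
    hence eq: "A * A = f * (B * B)" by (simp add: N_def)
    have "B = 0"
    proof (rule ccontr)
      assume B: "B \<noteq> 0"
      hence "A \<noteq> 0" using eq degf by auto
      hence "degree A + degree A = 3 + (degree B + degree B)"
        using B degf arg_cong[OF eq, of degree] by (simp add: degree_mult_eq)
      thus False by presburger
    qed
    moreover from this have "A = 0" using eq by auto
    ultimately have "h P0 = 0" using P0(1) AB(3,4)
      by (cases P0) (auto simp: weight_coeff_def)
    thus False using P0 by simp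
  qed
  have "?Z \<subseteq> {x. poly N x = 0}"
  proof clarify
    fix x y assume on: "on_curve E (Affine x y)" and h0: "h (Affine x y) = 0"
    define w where "w = y + half_line E x"
    hence "poly A x + w * poly B x = 0" using AB(3)[OF on] h0 by (simp add: w_def)
    hence "poly A x = - (w * poly B x)" by (simp add: eq_neg_iff_add_eq_0)
    hence "poly A x * poly A x = w\<^sup>2 * (poly B x * poly B x)"
      by (simp add: power2_eq_square)
    thus "poly N x = 0" using on unfolding on_curve_iff_square w_def by (simp add: N_def f_def)
  qed
  moreover have fin: "finite {x. poly N x = 0}" using \<open>N \<noteq> 0\<close> by (rule poly_roots_finite)
  ultimately show "finite ?Z" using finite_subset by blast
  \<comment> \<open>Both terms of the norm have weight at most \<open>6 * d\<close>; weight is twice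
    the degree, which gives the bound \<open>3 * d\<close>.\<close>
  have "weight_le (A * A) (3 * int d + 3 * int d)" by (intro weight_le_mult AB)
  moreover have "weight_le (f * (B * B)) (6 + ((3 * int d - 3) + (3 * int d - 3)))"
    unfolding f_def by (intro weight_le_mult weight_cubic AB)
  ultimately have "degree N \<le> 3 * d"
    by (intro degree_le) (auto simp: N_def weight_le_def)
  moreover have "card ?Z \<le> card {x. poly N x = 0}" using fin \<open>?Z \<subseteq> _\<close> by (rule card_mono)
  moreover have "card {x. poly N x = 0} \<le> degree N" using \<open>N \<noteq> 0\<close> by (rule card_poly_roots_bound)
  ultimately show "card ?Z \<le> 3 * d" by simp
qed

section \<open>Zeros of bihomogeneous polynomials on a product of curves\<close>

lemma eval_at_pair:
  "eval_at F (P, Q) = (\<Sum>m \<in> Poly_Mapping.keys F. to_ac (Poly_Mapping.lookup F m) *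
     ((\<Prod>i\<in>UNIV. homogeneous_coords P $ i ^ Poly_Mapping.lookup m (Inl i)) *
      (\<Prod>i\<in>UNIV. homogeneous_coords Q $ i ^ Poly_Mapping.lookup m (Inr i))))"
proof -
  have split: "(\<Prod>v\<in>UNIV. case_sum (($) (homogeneous_coords P)) (($) (homogeneous_coords Q)) v
      ^ Poly_Mapping.lookup m v) =
    (\<Prod>i\<in>UNIV. homogeneous_coords P $ i ^ Poly_Mapping.lookup m (Inl i)) *
      (\<Prod>i\<in>UNIV. homogeneous_coords Q $ i ^ Poly_Mapping.lookup m (Inr i))" for m :: "(3 + 3) \<Rightarrow>\<^sub>0 nat"
    unfolding UNIV_Plus_UNIV[symmetric] by (subst prod.Plus) simp_all
  show ?thesis unfolding eval_at_def fst_conv snd_conv by (simp only: split)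
qed

lemma regular_eval_at:
  fixes F :: "'k::field_char_0 biplane_poly" and E :: "'k alg_closure weierstrass"
  assumes "bihomogeneous d e F"
  shows "regular E d (\<lambda>P. eval_at F (P, Q))" and "regular E e (\<lambda>Q. eval_at F (P, Q))"
proof -
  have "regular E d (\<lambda>P. \<Sum>m \<in> Poly_Mapping.keys F. (to_ac (Poly_Mapping.lookup F m) *
      (\<Prod>i\<in>UNIV. homogeneous_coords Q $ i ^ Poly_Mapping.lookup m (Inr i))) *
      (\<Prod>i\<in>UNIV. homogeneous_coords P $ i ^ Poly_Mapping.lookup m (Inl i)))"
    by (rule regular_monomial_sum) (use assms in \<open>auto simp: bihomogeneous_def\<close>)
  thus "regular E d (\<lambda>P. eval_at F (P, Q))" by (simp add: eval_at_pair mult_ac)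
  have "regular E e (\<lambda>Q. \<Sum>m \<in> Poly_Mapping.keys F. (to_ac (Poly_Mapping.lookup F m) *
      (\<Prod>i\<in>UNIV. homogeneous_coords P $ i ^ Poly_Mapping.lookup m (Inl i))) *
      (\<Prod>i\<in>UNIV. homogeneous_coords Q $ i ^ Poly_Mapping.lookup m (Inr i)))"
    by (rule regular_monomial_sum) (use assms in \<open>auto simp: bihomogeneous_def\<close>)
  thus "regular E e (\<lambda>Q. eval_at F (P, Q))" by (simp add: eval_at_pair mult_ac)
qed

text \<open>If \<open>F\<close> is nonzero at \<open>(P0, Q0)\<close>, then for all but finitely
  many \<open>u\<close> it is nonzero at \<open>P0\<close> paired with any point over
  \<open>u\<close>. So it is not identically zero on that fibre, and its degree bounds the zeros
  independently of \<open>u\<close>.\<close>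

lemma eval_at_zeros:
  fixes F :: "'k::field_char_0 biplane_poly" and E E' :: "'k alg_closure weierstrass"
  assumes F: "bihomogeneous d e F" and P: "P \<in> points E \<times> points E'" "eval_at F P \<noteq> 0"
  shows "\<exists>B. finite B \<and> (\<forall>u v. u \<notin> B \<longrightarrow> on_curve E' (Affine u v) \<longrightarrow>
    finite {x. \<exists>y. on_curve E (Affine x y) \<and> eval_at F (Affine x y, Affine u v) = 0} \<and>
    card {x. \<exists>y. on_curve E (Affine x y) \<and> eval_at F (Affine x y, Affine u v) = 0} \<le> 3 * d)"
proof -
  obtain P0 Q0 where PQ: "P = (P0, Q0)" "on_curve E P0" "on_curve E' Q0" "eval_at F (P0, Q0) \<noteq> 0"
    using P by (cases P) (auto simp: points_def)
  define B where "B = {u. \<exists>v. on_curve E' (Affine u v) \<and> eval_at F (P0, Affine u v) = 0}"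
  have "finite B" unfolding B_def
    using regular_zeros(1)[OF regular_eval_at(2)[OF F, of E' P0] PQ(3,4)] .
  moreover have "finite {x. \<exists>y. on_curve E (Affine x y) \<and> eval_at F (Affine x y, Affine u v) = 0} \<and>
    card {x. \<exists>y. on_curve E (Affine x y) \<and> eval_at F (Affine x y, Affine u v) = 0} \<le> 3 * d"
    if "u \<notin> B" "on_curve E' (Affine u v)" for u v
  proof -
    have "eval_at F (P0, Affine u v) \<noteq> 0" using that by (auto simp: B_def)
    from regular_zeros[OF regular_eval_at(1)[OF F] PQ(2) this] show ?thesis by blast
  qed
  ultimately show ?thesis by blast
qed

lemma eval_at_zeros_finitely_many:
  fixes E E' :: "'k::field_char_0 alg_closure weierstrass"
  assumes "finite FF" and "\<And>F. F \<in> FF \<Longrightarrow> (\<exists>d e. bihomogeneous d e F) \<and> (\<exists>P \<in> points E \<times> points E'. eval_at F P \<noteq> 0)"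
  shows "\<exists>B N. finite B \<and> (\<forall>u v. u \<notin> B \<longrightarrow> on_curve E' (Affine u v) \<longrightarrow>
    finite {x. \<exists>F\<in>FF. \<exists>y. on_curve E (Affine x y) \<and> eval_at F (Affine x y, Affine u v) = 0} \<and>
    card {x. \<exists>F\<in>FF. \<exists>y. on_curve E (Affine x y) \<and> eval_at F (Affine x y, Affine u v) = 0} \<le> N)"
  using assms
proof (induction FF)
  case empty
  show ?case by auto
next
  case (insert F FF)
  define Z where "Z F u v = {x. \<exists>y. on_curve E (Affine x y) \<and> eval_at F (Affine x y, Affine u v) = 0}" for F u v
  define W where "W u v = {x. \<exists>F\<in>FF. \<exists>y. on_curve E (Affine x y) \<and> eval_at F (Affine x y, Affine u v) = 0}" for u v
  have "\<exists>B N. finite B \<and> (\<forall>u v. u \<notin> B \<longrightarrow> on_curve E' (Affine u v) \<longrightarrow>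
      finite (W u v) \<and> card (W u v) \<le> N)"
    unfolding W_def by (rule insert.IH) (rule insert.prems, blast)
  then obtain B N where B: "finite B" "\<And>u v. u \<notin> B \<Longrightarrow> on_curve E' (Affine u v) \<Longrightarrow>
      finite (W u v) \<and> card (W u v) \<le> N" by blast
  obtain d e P where "bihomogeneous d e F" "P \<in> points E \<times> points E'" "eval_at F P \<noteq> 0"
    using insert.prems by blast
  from eval_at_zeros[OF this] obtain C where C: "finite C" "\<And>u v. u \<notin> C \<Longrightarrow> on_curve E' (Affine u v) \<Longrightarrow>
      finite (Z F u v) \<and> card (Z F u v) \<le> 3 * d"
    unfolding Z_def by blast
  have un: "{x. \<exists>G\<in>insert F FF. \<exists>y. on_curve E (Affine x y) \<and> eval_at G (Affine x y, Affine u v) = 0} =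
      Z F u v \<union> W u v" for u v unfolding Z_def W_def by blast
  have "finite (Z F u v \<union> W u v) \<and> card (Z F u v \<union> W u v) \<le> 3 * d + N"
    if "u \<notin> B \<union> C" "on_curve E' (Affine u v)" for u v
    using B(2)[of u v] C(2)[of u v] that card_Un_le[of "Z F u v" "W u v"] by auto
  hence "finite (B \<union> C) \<and> (\<forall>u v. u \<notin> B \<union> C \<longrightarrow> on_curve E' (Affine u v) \<longrightarrow>
      finite (Z F u v \<union> W u v) \<and> card (Z F u v \<union> W u v) \<le> 3 * d + N)"
    using B(1) C(1) by blast
  thus ?case unfolding un by blast
qed

section \<open>Density from many points on many fibres\<close>

lemma generate_topology_on_finite_Inter:
  assumes "generate_topology_on S T" "x \<in> T"
  shows "\<exists>\<F>. finite \<F> \<and> \<F> \<subseteq> S \<and> x \<in> \<Inter>\<F> \<and> \<Inter>\<F> \<subseteq> T"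
  using assms
proof (induction rule: generate_topology_on.induct)
  case (Int a b)
  then obtain A B where "finite A" "A \<subseteq> S" "x \<in> \<Inter>A" "\<Inter>A \<subseteq> a" "finite B" "B \<subseteq> S" "x \<in> \<Inter>B" "\<Inter>B \<subseteq> b"
    by blast
  thus ?case by (intro exI[of _ "A \<union> B"]) auto
next
  case (UN K)
  then obtain k where "k \<in> K" "x \<in> k" by blast
  from UN.IH[OF this] obtain \<F> where "finite \<F>" "\<F> \<subseteq> S" "x \<in> \<Inter>\<F>" "\<Inter>\<F> \<subseteq> k" by blast
  with \<open>k \<in> K\<close> show ?case by (intro exI[of _ \<F>]) auto
next
  case (Basis s)
  thus ?case by (intro exI[of _ "{s}"]) auto
qed simp

text \<open>A neighbourhood contains a finite intersection of basic open sets, whose complement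
  meets all but finitely many fibres in at most \<open>N\<close> affine abscissae. A fibre with more
  than \<open>N\<close> abscissae of degree \<open>d\<close> points thus enters it. As
  \<open>N\<close> depends on the neighbourhood, the hypothesis is for every
  \<open>N\<close>.\<close>

lemma density_criterion:
  fixes E1 E2 :: "'k::field_char_0 weierstrass"
  defines "V \<equiv> geometric_points E1 \<times> geometric_points E2"
  assumes "d > 0"
    and inf: "\<And>N. infinite {u. \<exists>v S. finite S \<and> card S \<ge> N \<and>
      (\<forall>x\<in>S. \<exists>y. (Affine x y, Affine u v) \<in> V \<and> residue_degree (Affine x y, Affine u v) = d)}"
  shows "d \<in> \<delta> V"
proof -
  define E E' where "E = map_weierstrass to_ac E1" and "E' = map_weierstrass to_ac E2"
  have V: "V = points E \<times> points E'"
    by (simp add: V_def geometric_points_def E_def E'_def)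
  have "closed_points V \<subseteq> zariski V closure_of closed_points_of_degree d V"
  proof
    fix p assume p: "p \<in> closed_points V"
    show "p \<in> zariski V closure_of closed_points_of_degree d V"
      unfolding in_closure_of topspace_zariski
    proof (intro conjI allI impI p)
      fix T assume T: "p \<in> T \<and> openin (zariski V) T"
      hence "generate_topology_on {basic_open V F | F. \<exists>d e. bihomogeneous d e F} T" "p \<in> T"
        by (simp_all add: zariski_def openin_topology_generated_by_iff)
      from generate_topology_on_finite_Inter[OF this] obtain \<F> where \<F>: "finite \<F>" "\<F> \<subseteq> {basic_open V F | F. \<exists>d e. bihomogeneous d e F}"
        "p \<in> \<Inter>\<F>" "\<Inter>\<F> \<subseteq> T"
        by blast
      have "\<F> \<subseteq> basic_open V ` {F. \<exists>d e. bihomogeneous d e F}"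
        using \<F>(2) by (simp only: setcompr_eq_image)
      from finite_subset_image[OF \<F>(1) this] obtain FF where
        FF: "FF \<subseteq> {F. \<exists>d e. bihomogeneous d e F}" "finite FF" "\<F> = basic_open V ` FF" by blast
      \<comment> \<open>The closed point \<open>p\<close> shows that none of these polynomials
        vanishes identically on \<open>V\<close>.\<close>
      have "(\<exists>d e. bihomogeneous d e F) \<and> (\<exists>P \<in> points E \<times> points E'. eval_at F P \<noteq> 0)" if "F \<in> FF" for F
        using FF that \<F>(3) unfolding V basic_open_def by blast
      from eval_at_zeros_finitely_many[OF FF(2) this] obtain B N where BN: "finite B"
        "\<And>u v. u \<notin> B \<Longrightarrow> on_curve E' (Affine u v) \<Longrightarrow>
          finite {x. \<exists>F\<in>FF. \<exists>y. on_curve E (Affine x y) \<and> eval_at F (Affine x y, Affine u v) = 0} \<and>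
          card {x. \<exists>F\<in>FF. \<exists>y. on_curve E (Affine x y) \<and> eval_at F (Affine x y, Affine u v) = 0} \<le> N"
        by blast
      have "{u. \<exists>v S. finite S \<and> card S \<ge> Suc N \<and> (\<forall>x\<in>S. \<exists>y. (Affine x y, Affine u v) \<in> V \<and>
          residue_degree (Affine x y, Affine u v) = d)} - B \<noteq> {}"
        using Diff_infinite_finite[OF BN(1) inf[of "Suc N"]] by (rule infinite_imp_nonempty)
      then obtain u where u: "u \<notin> B" "\<exists>v S. finite S \<and> card S \<ge> Suc N \<and>
        (\<forall>x\<in>S. \<exists>y. (Affine x y, Affine u v) \<in> V \<and> residue_degree (Affine x y, Affine u v) = d)"
        by blast
      then obtain v S where S: "finite S" "card S \<ge> Suc N"
        "\<And>x. x \<in> S \<Longrightarrow> \<exists>y. (Affine x y, Affine u v) \<in> V \<and> residue_degree (Affine x y, Affine u v) = d"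
        by blast
      obtain x0 where "x0 \<in> S" using S by fastforce
      hence "on_curve E' (Affine u v)" using S(3)[of x0] by (auto simp: V points_def)
      note Z = BN(2)[OF u(1) this]
      have "\<not> S \<subseteq> {x. \<exists>F\<in>FF. \<exists>y. on_curve E (Affine x y) \<and> eval_at F (Affine x y, Affine u v) = 0}"
        using Z S(2) card_mono[of _ S] by fastforce
      then obtain x where x: "x \<in> S" "\<And>F y. F \<in> FF \<Longrightarrow> on_curve E (Affine x y) \<Longrightarrow>
          eval_at F (Affine x y, Affine u v) \<noteq> 0" by blast
      obtain y where y: "(Affine x y, Affine u v) \<in> V" "residue_degree (Affine x y, Affine u v) = d"
        using S(3) x(1) by blast
      define q where "q = galois_orbit (Affine x y, Affine u v)"
      have "q \<in> closed_points_of_degree d V" using y unfolding q_def closed_points_of_degree_def by blast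
      moreover have "q \<in> basic_open V F" if "F \<in> FF" for F
        using y(1) x(2)[OF that] unfolding basic_open_def q_def by (auto simp: V points_def)
      hence "q \<in> T" using \<F>(4) FF(3) by blast
      ultimately show "\<exists>y. y \<in> closed_points_of_degree d V \<and> y \<in> T" by blast
    qed
  qed
  moreover have "zariski V closure_of closed_points_of_degree d V \<subseteq> closed_points V"
    using closure_of_subset_topspace[of "zariski V"] by (simp add: topspace_zariski)
  ultimately show ?thesis using \<open>d > 0\<close> by (simp add: \<delta>_def)
qed

section \<open>Residue degrees\<close>

text \<open>\<open>k + k * s\<close> is closed under inverses: as \<open>D\<close> is a nonsquare,
  the norm \<open>a\<^sup>2 - b\<^sup>2 * D\<close> vanishes only at 0.\<close>

lemma field_adjoin_quadratic:
  fixes s :: "'k::field alg_closure"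
  assumes s: "s\<^sup>2 = to_ac D" "\<not> is_sq D" and T: "T \<subseteq> {to_ac a + to_ac b * s | a b. True}"
  shows "field_adjoin T \<subseteq> {to_ac a + to_ac b * s | a b. True}" (is "_ \<subseteq> ?Q")
proof
  fix x assume "x \<in> field_adjoin T"
  thus "x \<in> ?Q"
  proof induction
    case (base a)
    show ?case by (rule CollectI, rule exI[of _ a], rule exI[of _ 0]) simp
  next
    case (gen x)
    thus ?case using T by blast
  next
    case (diff x y)
    then obtain a b c d where "x = to_ac a + to_ac b * s" "y = to_ac c + to_ac d * s" by blast
    hence "x - y = to_ac (a - c) + to_ac (b - d) * s" by (simp add: algebra_simps)
    thus ?case by blast
  next
    case (mult x y)
    then obtain a b c d where xy: "x = to_ac a + to_ac b * s" "y = to_ac c + to_ac d * s" by blast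
    have "x * y = to_ac a * to_ac c + to_ac b * to_ac d * s\<^sup>2 + (to_ac a * to_ac d + to_ac b * to_ac c) * s"
      unfolding xy by (simp add: algebra_simps power2_eq_square)
    also have "\<dots> = to_ac (a * c + b * d * D) + to_ac (a * d + b * c) * s" using s by simp
    finally show ?case by blast
  next
    case (inverse x)
    then obtain a b where x: "x = to_ac a + to_ac b * s" by blast
    define n where "n = a\<^sup>2 - b\<^sup>2 * D"
    have norm: "x * (to_ac a - to_ac b * s) = to_ac n"
    proof -
      have "x * (to_ac a - to_ac b * s) = to_ac a * to_ac a - to_ac b * to_ac b * s\<^sup>2"
        unfolding x by (simp add: algebra_simps power2_eq_square)
      thus ?thesis using s by (simp add: n_def power2_eq_square)
    qed
    show ?case
    proof (cases "n = 0")
      case True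
      have "b = 0"
      proof (rule ccontr)
        assume "b \<noteq> 0"
        hence "D = a\<^sup>2 / b\<^sup>2" using True by (simp add: n_def eq_divide_eq mult.commute)
        hence "D = (a / b)\<^sup>2" by (simp only: power_divide)
        thus False using s(2) by (auto simp: is_sq_def)
      qed
      hence "x = 0" using True by (simp add: n_def x)
      hence "inverse x = to_ac 0 + to_ac 0 * s" by simp
      thus ?thesis by blast
    next
      case False
      hence "x * ((to_ac a - to_ac b * s) / to_ac n) = 1" using norm by simp
      hence "inverse x = (to_ac a - to_ac b * s) / to_ac n"
        using inverse_unique by blast
      also have "\<dots> = to_ac (a / n) + to_ac (- b / n) * s" using False by (simp add: field_simps)
      finally show ?thesis by blast
    qed
  qed
qed

text \<open>The field lies in \<open>k + k * s\<close>, and the generator outside \<open>k\<close>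
  puts \<open>s\<close> into it, so \<open>{1, s}\<close> is a basis.\<close>

lemma dim_field_adjoin_quadratic:
  fixes s :: "'k::field alg_closure"
  assumes s: "s\<^sup>2 = to_ac D" "\<not> is_sq D" and T: "T \<subseteq> {to_ac a + to_ac b * s | a b. True}"
    and c: "c \<in> T" "c \<notin> range to_ac"
  shows "vector_space.dim (\<lambda>(a :: 'k) x. to_ac a * x) (field_adjoin T) = 2"
proof -
  interpret V: vector_space "\<lambda>(a :: 'k) (x :: 'k alg_closure). to_ac a * x"
    by (rule vector_space_alg_closure)
  have sr: "s \<notin> range to_ac"
  proof
    assume "s \<in> range to_ac"
    then obtain r where "s = to_ac r" by blast
    hence "to_ac (r\<^sup>2) = to_ac D" using s(1) by simp
    thus False using s(2) unfolding to_ac_eq_iff is_sq_def by blast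
  qed
  obtain a b where ab: "c = to_ac a + to_ac b * s" using c(1) T by blast
  have "b \<noteq> 0" using c(2) ab by auto
  hence "s = (c - to_ac a) * inverse (to_ac b)" by (simp add: ab)
  hence "s \<in> field_adjoin T" using c(1)
    by (auto intro!: field_adjoin.mult field_adjoin.diff field_adjoin.inverse
      intro: field_adjoin.base field_adjoin.gen)
  moreover have "1 \<in> field_adjoin T" using field_adjoin.base[of 1] by simp
  ultimately have 1: "{1, s} \<subseteq> field_adjoin T" by simp
  have 2: "field_adjoin T \<subseteq> V.span {1, s}"
  proof
    fix x assume "x \<in> field_adjoin T"
    then obtain a b where "x = to_ac a * 1 + to_ac b * s"
      using field_adjoin_quadratic[OF s T] by auto
    moreover have "to_ac a * 1 + to_ac b * s \<in> V.span {1, s}"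
      by (intro V.span_add V.span_scale V.span_base) auto
    ultimately show "x \<in> V.span {1, s}" by simp
  qed
  have "s \<notin> V.span {1}" using sr by (auto simp: V.span_singleton)
  hence "V.independent (insert s {1})" by (simp add: V.independent_insert)
  hence 3: "V.independent {1, s}" by (simp add: insert_commute)
  have "s \<noteq> 1" using sr to_ac_1 by (metis rangeI)
  hence "card {1, s} = 2" by simp
  with V.dim_unique[OF 1 2 3] show ?thesis by blast
qed

lemma to_ac_poly_cubic:
  "poly (weierstrass_cubic (map_weierstrass to_ac E)) (to_ac x) = to_ac (poly (weierstrass_cubic E) x)"
  by (cases E) (simp add: weierstrass_cubic_def b2_def b4_def b6_def)

lemma to_ac_half_line: "half_line (map_weierstrass to_ac E) (to_ac x) = to_ac (half_line E x)"
  by (cases E) (simp add: half_line_def)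

lemma quadratic_square_root:
  fixes s :: "'k::field alg_closure"
  assumes "s\<^sup>2 = to_ac D" "w\<^sup>2 = to_ac p" "p = r\<^sup>2 \<or> p = r\<^sup>2 * D"
  shows "\<exists>a b. w = to_ac a + to_ac b * s"
  using assms(3)
proof
  assume "p = r\<^sup>2"
  hence "w\<^sup>2 = (to_ac r)\<^sup>2" using assms by simp
  hence "w = to_ac r + to_ac 0 * s \<or> w = to_ac (- r) + to_ac 0 * s" by (simp add: power2_eq_iff)
  thus ?thesis by blast
next
  assume "p = r\<^sup>2 * D"
  hence "w\<^sup>2 = (to_ac r * s)\<^sup>2" using assms by (simp add: power_mult_distrib)
  hence "w = to_ac 0 + to_ac r * s \<or> w = to_ac 0 + to_ac (- r) * s" by (simp add: power2_eq_iff)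
  thus ?thesis by blast
qed

text \<open>Both ordinates lie in the common quadratic field. They are not both in \<open>k\<close>,
  since a rational ordinate makes its cubic value a square in \<open>k\<close>.\<close>

lemma quadratic_point:
  fixes E1 E2 :: "'k::field_char_0 weierstrass"
  assumes sq: "sq_in_quadratic (poly (weierstrass_cubic E1) x) (poly (weierstrass_cubic E2) u)"
    and w: "w\<^sup>2 = to_ac (poly (weierstrass_cubic E1) x)"
    and z: "z\<^sup>2 = to_ac (poly (weierstrass_cubic E2) u)"
  defines "P \<equiv> (Affine (to_ac x) (w - to_ac (half_line E1 x)), Affine (to_ac u) (z - to_ac (half_line E2 u)))"
  shows "P \<in> geometric_points E1 \<times> geometric_points E2" and "residue_degree P = 2"
proof -
  show "P \<in> geometric_points E1 \<times> geometric_points E2"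
    using w z unfolding P_def geometric_points_def points_def
    by (simp add: on_curve_iff_square to_ac_half_line to_ac_poly_cubic del: on_curve.simps)
  define p q where "p = poly (weierstrass_cubic E1) x" and "q = poly (weierstrass_cubic E2) u"
  from sq obtain D r r' where D: "\<not> is_sq D" "p = r\<^sup>2 \<or> p = r\<^sup>2 * D" "q = r'\<^sup>2 \<or> q = r'\<^sup>2 * D"
    and nsq: "\<not> (is_sq p \<and> is_sq q)"
    unfolding sq_in_quadratic_def p_def q_def by blast
  obtain s :: "'k alg_closure" where s: "s\<^sup>2 = to_ac D"
    using nth_root_exists[of 2 "to_ac D"] by auto
  obtain a b where w': "w = to_ac a + to_ac b * s"
    using quadratic_square_root[OF s w[folded p_def] D(2)] by blast
  obtain a' b' where z': "z = to_ac a' + to_ac b' * s"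
    using quadratic_square_root[OF s z[folded q_def] D(3)] by blast
  define h h' where "h = half_line E1 x" and "h' = half_line E2 u"
  define T where "T = {to_ac x, w - to_ac h, to_ac u, z - to_ac h'}"
  have T: "T \<subseteq> {to_ac a + to_ac b * s | a b. True}"
  proof -
    have "to_ac c = to_ac c + to_ac 0 * s" for c by simp
    moreover have "w - to_ac h = to_ac (a - h) + to_ac b * s" by (simp add: w')
    moreover have "z - to_ac h' = to_ac (a' - h') + to_ac b' * s" by (simp add: z')
    ultimately show ?thesis unfolding T_def by blast
  qed
  have sqI: "is_sq e" if "v\<^sup>2 = to_ac e" "v - to_ac c \<in> range to_ac" for v c and e :: 'k
  proof -
    from that(2) obtain d where "v - to_ac c = to_ac d" by blast
    hence "v = to_ac (d + c)" by (simp add: diff_eq_eq)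
    hence "to_ac e = to_ac ((d + c)\<^sup>2)" using that(1) by simp
    thus ?thesis unfolding to_ac_eq_iff is_sq_def by blast
  qed
  have "w - to_ac h \<notin> range to_ac \<or> z - to_ac h' \<notin> range to_ac"
    using sqI w z nsq unfolding p_def q_def by blast
  then obtain c where "c \<in> T" "c \<notin> range to_ac" unfolding T_def by blast
  from dim_field_adjoin_quadratic[OF s D(1) T this]
  show "residue_degree P = 2"
    unfolding residue_degree_def residue_field_def P_def
    by (simp add: T_def h_def h'_def insert_commute)
qed

lemma two_in_delta:
  fixes E1 E2 :: "'k::field_char_0 weierstrass"
  assumes "\<And>N. infinite {u. \<exists>S. finite S \<and> card S \<ge> N \<and> (\<forall>x\<in>S.
    sq_in_quadratic (poly (weierstrass_cubic E1) x) (poly (weierstrass_cubic E2) u))}"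
  shows "2 \<in> \<delta> (geometric_points E1 \<times> geometric_points E2)"
proof (rule density_criterion)
  fix N
  define G where "G = {u. \<exists>S. finite S \<and> card S \<ge> N \<and> (\<forall>x\<in>S.
    sq_in_quadratic (poly (weierstrass_cubic E1) x) (poly (weierstrass_cubic E2) u))}"
  have "infinite G" unfolding G_def by (rule assms)
  hence inf: "infinite (to_ac ` G)"
    using finite_imageD[of to_ac G] inj_on_subset[OF inj_to_ac subset_UNIV] by blast
  have "\<exists>v S. finite S \<and> card S \<ge> N \<and> (\<forall>x\<in>S. \<exists>y.
      (Affine x y, Affine (to_ac u) v) \<in> geometric_points E1 \<times> geometric_points E2 \<and>
      residue_degree (Affine x y, Affine (to_ac u) v) = 2)" if "u \<in> G" for u
  proof -
    from that obtain S where S0: "finite S \<and> card S \<ge> N \<and> (\<forall>x\<in>S.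
      sq_in_quadratic (poly (weierstrass_cubic E1) x) (poly (weierstrass_cubic E2) u))"
      unfolding G_def by (elim CollectE exE)
    hence S: "finite S" "card S \<ge> N" by simp_all
    have sq: "sq_in_quadratic (poly (weierstrass_cubic E1) x)
      (poly (weierstrass_cubic E2) u)" if "x \<in> S" for x using S0 that by (elim conjE) (rule bspec)
    \<comment> \<open>Chosen before \<open>x\<close>, because one point over \<open>u\<close> has to
      serve all of \<open>S\<close>.\<close>
    obtain z :: "'k alg_closure" where z: "z\<^sup>2 = to_ac (poly (weierstrass_cubic E2) u)"
      using nth_root_exists[of 2 "to_ac (poly (weierstrass_cubic E2) u)"] by auto
    have "\<exists>y. (Affine (to_ac x) y, Affine (to_ac u) (z - to_ac (half_line E2 u))) \<in>
        geometric_points E1 \<times> geometric_points E2 \<and>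
      residue_degree (Affine (to_ac x) y, Affine (to_ac u) (z - to_ac (half_line E2 u))) = 2"
      if "x \<in> S" for x
    proof -
      obtain w :: "'k alg_closure" where w: "w\<^sup>2 = to_ac (poly (weierstrass_cubic E1) x)"
        using nth_root_exists[of 2 "to_ac (poly (weierstrass_cubic E1) x)"] by auto
      from quadratic_point[OF sq[OF that] w z] show ?thesis by blast
    qed
    moreover have "finite (to_ac ` S)" "card (to_ac ` S) \<ge> N"
      using S inj_on_subset[OF inj_to_ac, of S] by (auto simp: card_image)
    ultimately show ?thesis
      by (intro exI[of _ "z - to_ac (half_line E2 u)"] exI[of _ "to_ac ` S"]) auto
  qed
  hence "to_ac ` G \<subseteq> {u. \<exists>v S. finite S \<and> card S \<ge> N \<and> (\<forall>x\<in>S. \<exists>y.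
      (Affine x y, Affine u v) \<in> geometric_points E1 \<times> geometric_points E2 \<and>
      residue_degree (Affine x y, Affine u v) = 2)}"
    by blast
  thus "infinite {u. \<exists>v S. finite S \<and> card S \<ge> N \<and> (\<forall>x\<in>S. \<exists>y.
      (Affine x y, Affine u v) \<in> geometric_points E1 \<times> geometric_points E2 \<and>
      residue_degree (Affine x y, Affine u v) = 2)}"
    using inf by (rule infinite_super)
qed simp

section \<open>Rational curves on the twists\<close>

text \<open>Linear coefficient of the depressed cubic, in which the mean of the roots is moved to 0;
  \<open>dep_q\<close> is its constant term.\<close>

definition dep_p :: "'a::field \<Rightarrow> 'a \<Rightarrow> 'a"
  where "dep_p a b = b - a\<^sup>2 / 3"

definition dep_q :: "'a::field \<Rightarrow> 'a \<Rightarrow> 'a \<Rightarrow> 'a"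
  where "dep_q a b c = c - a * b / 3 + 2 * a ^ 3 / 27"

definition cub_disc :: "'a::field \<Rightarrow> 'a \<Rightarrow> 'a \<Rightarrow> 'a"
  where "cub_disc a b c = - (4 * dep_p a b ^ 3 + 27 * (dep_q a b c)\<^sup>2)"

lemma cub_depressed:
  fixes a :: "'a::field_char_0"
  shows "cub a b c (x - a / 3) = x ^ 3 + dep_p a b * x + dep_q a b c"
  by (simp add: cub_def dep_p_def dep_q_def field_simps power2_eq_square power3_eq_cube)

lemma cub_at_root:
  fixes a :: "'a::field_char_0"
  assumes "cub a b c e = 0"
  shows "cub a b c (x + e) = x ^ 3 + (3 * e + a) * x\<^sup>2 + cub_deriv a b e * x"
proof -
  have "cub a b c (x + e) = x ^ 3 + (3 * e + a) * x\<^sup>2 + cub_deriv a b e * x + cub a b c e"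
    by (simp add: cub_def cub_deriv_def algebra_simps power2_eq_square power3_eq_cube)
  thus ?thesis using assms by simp
qed

text \<open>A double root, at \<open>t\<close> after the shift, forces
  \<open>dep_p = - 3 * t\<^sup>2\<close> and \<open>dep_q = 2 * t ^ 3\<close>, so the discriminant
  vanishes.\<close>

lemma cub_deriv_root_nonzero:
  fixes a :: "'a::field_char_0"
  assumes "cub a b c e = 0" "cub_disc a b c \<noteq> 0"
  shows "cub_deriv a b e \<noteq> 0"
proof
  define t where "t = e + a / 3"
  assume "cub_deriv a b e = 0"
  moreover have "cub_deriv a b e = 3 * t\<^sup>2 + dep_p a b"
    by (simp add: cub_deriv_def dep_p_def t_def field_simps power2_eq_square)
  ultimately have p: "dep_p a b = - (3 * t\<^sup>2)" by (simp add: eq_neg_iff_add_eq_0 add.commute)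
  have "t ^ 3 + dep_p a b * t + dep_q a b c = 0"
    using cub_depressed[of a b c t] assms by (simp add: t_def)
  hence q: "dep_q a b c = 2 * t ^ 3"
    unfolding p by (simp add: algebra_simps power2_eq_square power3_eq_cube add_eq_0_iff)
  have "cub_disc a b c = 0" unfolding cub_disc_def p q by (simp add: eval_nat_numeral)
  thus False using assms by simp
qed

lemma finite_ratio_fibre:
  assumes "R \<noteq> 0" "N \<noteq> smult y R"
  shows "finite {D. poly N D / poly R D = (y :: 'a::field)}"
proof (rule finite_subset)
  show "{D. poly N D / poly R D = y} \<subseteq> {D. poly R D = 0} \<union> {D. poly (N - smult y R) D = 0}"
    by (auto simp: divide_eq_eq)
  show "finite ({D. poly R D = 0} \<union> {D. poly (N - smult y R) D = 0})"
    using assms by (intro finite_UnI poly_roots_finite) auto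
qed

text \<open>Substituting \<open>u = D * x\<close>, up to translations, in \<open>D ^ 3 * f x = g u\<close> leaves an equation that is linear
  in \<open>x\<close> if \<open>f\<close> and \<open>g\<close> are both depressed or both have their root at 0; \<open>N / R\<close> is its solution.\<close>

lemma infinite_quadratic_pairs_of_line:
  fixes N R :: "'k::field_char_0 poly"
  assumes D0: "\<not> is_sq (D0 :: 'k)"
    and twist: "\<And>D x. poly R D \<noteq> 0 \<Longrightarrow> x = poly N D / poly R D \<Longrightarrow>
      D ^ 3 * cub a b c (x + e) = cub a' b' c' (D * x + e')"
    and R: "R \<noteq> 0" and X: "\<And>y. N \<noteq> smult y R" and U: "\<And>y. [:0, 1:] * N \<noteq> smult y R"
  shows "infinite {u. \<exists>S. finite S \<and> card S \<ge> n \<and>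
    (\<forall>x\<in>S. sq_in_quadratic (cub a b c x) (cub a' b' c' u))}"
proof (rule infinite_quadratic_pairs[OF D0])
  define \<xi> where "\<xi> D = poly N D / poly R D + e" for D
  define \<eta> where "\<eta> D = poly ([:0, 1:] * N) D / poly R D + e'" for D
  have "{D. D ^ 3 * cub a b c (\<xi> D) \<noteq> cub a' b' c' (\<eta> D)} \<subseteq> {D. poly R D = 0}"
    using twist[OF _ refl] by (auto simp: \<xi>_def \<eta>_def)
  thus "finite {D. D ^ 3 * cub a b c (\<xi> D) \<noteq> cub a' b' c' (\<eta> D)}"
    using poly_roots_finite[OF R] by (rule finite_subset)
  show "finite {D. \<xi> D = y}" for y
    using finite_ratio_fibre[OF R X[of "y - e"]] by (simp add: \<xi>_def eq_diff_eq)
  show "finite {D. \<eta> D = y}" for y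
    using finite_ratio_fibre[OF R U[of "y - e'"]] by (simp add: \<eta>_def eq_diff_eq)
qed

lemma infinite_quadratic_pairs_depressed:
  fixes a b c a' b' c' :: "'k::field_char_0"
  assumes D0: "\<not> is_sq (D0 :: 'k)"
    and disc: "cub_disc a b c \<noteq> 0" "cub_disc a' b' c' \<noteq> 0"
    and p: "dep_p a b \<noteq> 0 \<or> dep_p a' b' \<noteq> 0"
    and q: "dep_q a b c \<noteq> 0 \<or> dep_q a' b' c' \<noteq> 0"
  shows "infinite {u. \<exists>S. finite S \<and> card S \<ge> n \<and>
    (\<forall>x\<in>S. sq_in_quadratic (cub a b c x) (cub a' b' c' u))}"
proof -
  define p q p' q' where "p = dep_p a b" and "q = dep_q a b c" and "p' = dep_p a' b'" and "q' = dep_q a' b' c'"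
  have pq: "p = 0 \<Longrightarrow> q \<noteq> 0" "p' = 0 \<Longrightarrow> q' \<noteq> 0" "p \<noteq> 0 \<or> p' \<noteq> 0" "q \<noteq> 0 \<or> q' \<noteq> 0"
    using assms by (auto simp: cub_disc_def p_def q_def p'_def q'_def)
  define N R where "N = [:q', 0, 0, - q:]" and "R = [:0, - p', 0, p:]"
  show ?thesis
  proof (rule infinite_quadratic_pairs_of_line[OF D0])
    fix D x assume R: "poly R D \<noteq> 0" and x: "x = poly N D / poly R D"
    hence "x * poly R D = poly N D" by simp
    hence "D ^ 3 * (p * x) - D * (p' * x) = q' - D ^ 3 * q"
      by (simp add: N_def R_def algebra_simps power3_eq_cube)
    hence "D ^ 3 * (x ^ 3 + p * x + q) = (D * x) ^ 3 + p' * (D * x) + q'"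
      by (simp add: algebra_simps power_mult_distrib)
    thus "D ^ 3 * cub a b c (x + - a / 3) = cub a' b' c' (D * x + - a' / 3)"
      using cub_depressed[of a b c x] cub_depressed[of a' b' c' "D * x"]
      by (simp add: p_def q_def p'_def q'_def)
  next
    \<comment> \<open>\<open>R\<close> vanishes only if \<open>p = p' = 0\<close>, and
      \<open>N\<close> only if \<open>q = q' = 0\<close>. If \<open>N / R\<close> or
      \<open>D * N / R\<close> were a nonzero constant, \<open>p\<close> and \<open>q\<close> of one
      curve would both vanish, against its discriminant.\<close>
    show "R \<noteq> 0" using pq by (auto simp: R_def)
    show "N \<noteq> smult y R" for y using pq by (auto simp: N_def R_def)
    show "[:0, 1:] * N \<noteq> smult y R" for y using pq by (auto simp: N_def R_def)
  qed
qed

lemma infinite_quadratic_pairs_roots: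
  fixes a b c a' b' c' :: "'k::field_char_0"
  assumes D0: "\<not> is_sq (D0 :: 'k)"
    and disc: "cub_disc a b c \<noteq> 0" "cub_disc a' b' c' \<noteq> 0"
    and e: "cub a b c e = 0" "cub a' b' c' e' = 0" "3 * e + a \<noteq> 0"
  shows "infinite {u. \<exists>S. finite S \<and> card S \<ge> n \<and>
    (\<forall>x\<in>S. sq_in_quadratic (cub a b c x) (cub a' b' c' u))}"
proof -
  define p q r m where "p = 3 * e + a" and "q = cub_deriv a b e" and "r = 3 * e' + a'" and "m = cub_deriv a' b' e'"
  have nz: "p \<noteq> 0" "q \<noteq> 0" "m \<noteq> 0"
    using assms cub_deriv_root_nonzero by (auto simp: p_def q_def m_def)
  define N R where "N = [:m, 0, - q:]" and "R = [:0, - r, p:]"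
  show ?thesis
  proof (rule infinite_quadratic_pairs_of_line[OF D0])
    fix D x assume R: "poly R D \<noteq> 0" and x: "x = poly N D / poly R D"
    hence "x * poly R D = poly N D" by simp
    hence "D\<^sup>2 * (p * x) - D * (r * x) = m - D\<^sup>2 * q"
      by (simp add: N_def R_def algebra_simps power2_eq_square)
    \<comment> \<open>The twist equation is divisible by \<open>D * x\<close>, as both cubics have a
      root at 0; the factor is restored here.\<close>
    hence "D * x * (D\<^sup>2 * (p * x) + D\<^sup>2 * q) = D * x * (D * (r * x) + m)"
      by (simp add: algebra_simps)
    hence "D ^ 3 * (x ^ 3 + p * x\<^sup>2 + q * x) = (D * x) ^ 3 + r * (D * x)\<^sup>2 + m * (D * x)"
      by (simp add: algebra_simps power2_eq_square power3_eq_cube)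
    thus "D ^ 3 * cub a b c (x + e) = cub a' b' c' (D * x + e')"
      unfolding cub_at_root[OF e(1)] cub_at_root[OF e(2)] p_def q_def r_def m_def .
  next
    show "R \<noteq> 0" using nz by (auto simp: R_def)
    \<comment> \<open>\<open>R\<close> has degree 2 and constant term 0, whereas \<open>N\<close>
      has constant term \<open>m \<noteq> 0\<close> and \<open>D * N\<close> has degree 3.\<close>
    show "N \<noteq> smult y R" for y using nz by (auto simp: N_def R_def)
    show "[:0, 1:] * N \<noteq> smult y R" for y using nz by (auto simp: N_def R_def)
  qed
qed

section \<open>Invariants and 2-torsion of Weierstrass curves\<close>

lemma discriminant_cub_disc:
  fixes E :: "'k::field_char_0 weierstrass"
  shows "discriminant E = 16 * cub_disc (b2 E / 4) (b4 E / 2) (b6 E / 4)"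
proof -
  have "4 * b8 E = b2 E * b6 E - (b4 E)\<^sup>2"
    by (simp add: b2_def b4_def b6_def b8_def algebra_simps power2_eq_square)
  hence b8: "b8 E = (b2 E * b6 E - (b4 E)\<^sup>2) / 4" by (simp add: field_simps)
  show ?thesis unfolding discriminant_def b8 cub_disc_def dep_p_def dep_q_def
    by (simp add: field_simps eval_nat_numeral)
qed

lemma c4_dep_p:
  fixes E :: "'k::field_char_0 weierstrass"
  shows "c4 E = - 48 * dep_p (b2 E / 4) (b4 E / 2)"
  by (simp add: c4_def dep_p_def field_simps power2_eq_square)

lemma j_invariant_zero: "dep_p (b2 E / 4) (b4 E / 2) = 0 \<Longrightarrow> j_invariant E = 0"
  for E :: "'k::field_char_0 weierstrass"
  by (simp add: j_invariant_def c4_dep_p)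

lemma j_invariant_1728:
  fixes E :: "'k::field_char_0 weierstrass"
  assumes "elliptic_curve E" "dep_q (b2 E / 4) (b4 E / 2) (b6 E / 4) = 0"
  shows "j_invariant E = 1728"
proof -
  define p where "p = dep_p (b2 E / 4) (b4 E / 2)"
  have d: "discriminant E = - 64 * p ^ 3"
    unfolding discriminant_cub_disc cub_disc_def assms(2) p_def by simp
  hence "p \<noteq> 0" using assms(1) by (auto simp: elliptic_curve_def)
  \<comment> \<open>\<open>110592 = 48 ^ 3 = 64 * 1728\<close>.\<close>
  have "c4 E ^ 3 = - 110592 * p ^ 3" unfolding c4_dep_p p_def by (simp add: eval_nat_numeral)
  thus ?thesis unfolding j_invariant_def d using \<open>p \<noteq> 0\<close> by simp
qed

text \<open>A root is the abscissa of a point with \<open>w = 0\<close>, which is its own negative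
  and hence 2-torsion.\<close>

lemma torsion_root_rational:
  fixes E :: "'k::field_char_0 weierstrass"
  assumes tors: "torsion 2 E \<subseteq> rational_points E"
    and root: "poly (weierstrass_cubic (map_weierstrass to_ac E)) x = 0"
  shows "x \<in> range to_ac"
proof -
  define F where "F = map_weierstrass to_ac E"
  define y where "y = - half_line F x"
  have "on_curve F (Affine x y)" unfolding on_curve_iff_square using root by (simp add: y_def F_def)
  moreover have "2 * y + a\<^sub>1 F * x + a\<^sub>3 F = 0" by (simp add: y_def half_line_def)
  hence "ec_add F (Affine x y) (Affine x y) = Infinity" by (simp only: ec_add.simps mult_2 if_True simp_thms refl)
  ultimately have "Affine x y \<in> torsion 2 E"
    by (simp add: torsion_def geometric_points_def points_def F_def numeral_2_eq_2)
  hence "Affine x y \<in> map_ec_point to_ac ` points E" using tors by (auto simp: rational_points_def)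
  then obtain P where "Affine x y = map_ec_point to_ac P" by blast
  thus ?thesis by (cases P) auto
qed

text \<open>The mean of the roots is \<open>- a / 3\<close>. If the root found is the mean, then
  \<open>dep_q = 0\<close>, and the square roots of \<open>- dep_p \<noteq> 0\<close> give roots
  away from it.\<close>

lemma cub_root_not_mean:
  fixes a b c :: "'a::{alg_closed_field, field_char_0}"
  assumes "cub_disc a b c \<noteq> 0"
  shows "\<exists>x. cub a b c x = 0 \<and> 3 * x + a \<noteq> 0"
proof -
  obtain x where "poly [:c, b, a, 1:] x = 0"
    using alg_closed_imp_poly_has_root[of "[:c, b, a, 1:]"] by auto
  hence x: "cub a b c x = 0" by (simp add: cub_def algebra_simps power2_eq_square power3_eq_cube)
  show ?thesis
  proof (cases "3 * x + a = 0")
    case True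
    hence "3 * x = - a" by (simp add: eq_neg_iff_add_eq_0)
    hence "x = - a / 3" by (metis nonzero_mult_div_cancel_left zero_neq_numeral)
    hence xa: "x = 0 - a / 3" by simp
    hence q: "dep_q a b c = 0" using x cub_depressed[of a b c 0] by simp
    hence p: "dep_p a b \<noteq> 0" using assms by (auto simp: cub_disc_def)
    obtain s where s: "s\<^sup>2 = - dep_p a b" using nth_root_exists[of 2 "- dep_p a b"] by auto
    have "cub a b c (s - a / 3) = s * (s\<^sup>2 + dep_p a b)"
      unfolding cub_depressed q by (simp add: algebra_simps power2_eq_square power3_eq_cube)
    moreover have "3 * (s - a / 3) + a \<noteq> 0" using s p by (auto simp: algebra_simps)
    ultimately show ?thesis using s by (intro exI[of _ "s - a / 3"]) simp
  qed (use x in blast)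
qed

lemma b_invariants_to_ac:
  fixes E :: "'k::field_char_0 weierstrass"
  shows "b2 (map_weierstrass to_ac E) = to_ac (b2 E)" "b4 (map_weierstrass to_ac E) = to_ac (b4 E)"
    "b6 (map_weierstrass to_ac E) = to_ac (b6 E)" "b8 (map_weierstrass to_ac E) = to_ac (b8 E)"
  by (cases E; simp add: b2_def b4_def b6_def b8_def)+

text \<open>Rational 2-torsion brings a root off the mean down from the closure to \<open>k\<close>;
  its second condition becomes the nonzero leading coefficient of \<open>R\<close> in
  \<open>infinite_quadratic_pairs_roots\<close>.\<close>

lemma torsion_imp_root:
  fixes E :: "'k::field_char_0 weierstrass"
  assumes "elliptic_curve E" "torsion 2 E \<subseteq> rational_points E"
  shows "\<exists>e. cub (b2 E / 4) (b4 E / 2) (b6 E / 4) e = 0 \<and> 3 * e + b2 E / 4 \<noteq> 0"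
proof -
  define F where "F = map_weierstrass to_ac E"
  have "discriminant F = to_ac (discriminant E)"
    unfolding F_def discriminant_def b_invariants_to_ac by simp
  hence "cub_disc (b2 F / 4) (b4 F / 2) (b6 F / 4) \<noteq> 0"
    using assms(1) by (simp add: discriminant_cub_disc elliptic_curve_def)
  from cub_root_not_mean[OF this] obtain x where
    x: "cub (b2 F / 4) (b4 F / 2) (b6 F / 4) x = 0" "3 * x + b2 F / 4 \<noteq> 0" by blast
  have "poly (weierstrass_cubic F) x = 0" using x by (simp add: poly_weierstrass_cubic)
  then obtain e where e: "x = to_ac e"
    using torsion_root_rational[OF assms(2)] unfolding F_def by blast
  have "to_ac (poly (weierstrass_cubic E) e) = 0"
    using x(1) unfolding e poly_weierstrass_cubic[symmetric] F_def to_ac_poly_cubic .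
  moreover have "to_ac (3 * e + b2 E / 4) \<noteq> 0"
    using x(2) by (simp add: e F_def b_invariants_to_ac)
  ultimately show ?thesis unfolding poly_weierstrass_cubic by (metis to_ac_0 to_ac_eq_0_iff)
qed

theorem theorem4p3:
  fixes E1 E2 :: "'k::number_field weierstrass"
  assumes "elliptic_curve E1" and "elliptic_curve E2"
  shows "(\<not> (j_invariant E1 = 0 \<and> j_invariant E2 = 0) \<and>
          \<not> (j_invariant E1 = 1728 \<and> j_invariant E2 = 1728) \<longrightarrow>
          2 \<in> \<delta> (geometric_points E1 \<times> geometric_points E2)) \<and>
         (torsion 2 E1 \<subseteq> rational_points E1 \<and> torsion 2 E2 \<subseteq> rational_points E2 \<longrightarrow>
          2 \<in> \<delta> (geometric_points E1 \<times> geometric_points E2))"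
proof -
  obtain D0 :: 'k where D0: "\<not> is_sq D0"
    using number_field_nonsquare unfolding is_sq_def by blast
  have disc: "cub_disc (b2 E1 / 4) (b4 E1 / 2) (b6 E1 / 4) \<noteq> 0"
    "cub_disc (b2 E2 / 4) (b4 E2 / 2) (b6 E2 / 4) \<noteq> 0"
    using assms by (auto simp: elliptic_curve_def discriminant_cub_disc)
  show ?thesis
  proof (intro conjI impI)
    assume j: "\<not> (j_invariant E1 = 0 \<and> j_invariant E2 = 0) \<and>
      \<not> (j_invariant E1 = 1728 \<and> j_invariant E2 = 1728)"
    show "2 \<in> \<delta> (geometric_points E1 \<times> geometric_points E2)"
      \<comment> \<open>By contraposition: \<open>dep_p = 0\<close> gives \<open>j = 0\<close>, and
        \<open>dep_q = 0\<close> gives \<open>j = 1728\<close>.\<close>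
      by (rule two_in_delta, unfold poly_weierstrass_cubic,
        rule infinite_quadratic_pairs_depressed[OF D0 disc])
        (use j j_invariant_zero j_invariant_1728 assms in blast)+
  next
    assume t: "torsion 2 E1 \<subseteq> rational_points E1 \<and> torsion 2 E2 \<subseteq> rational_points E2"
    obtain e where e: "cub (b2 E1 / 4) (b4 E1 / 2) (b6 E1 / 4) e = 0" "3 * e + b2 E1 / 4 \<noteq> 0"
      using torsion_imp_root[OF assms(1)] t by blast
    obtain e' where e': "cub (b2 E2 / 4) (b4 E2 / 2) (b6 E2 / 4) e' = 0"
      using torsion_imp_root[OF assms(2)] t by blast
    show "2 \<in> \<delta> (geometric_points E1 \<times> geometric_points E2)"
      by (rule two_in_delta, unfold poly_weierstrass_cubic,
        rule infinite_quadratic_pairs_roots[OF D0 disc e(1) e' e(2)])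
  qed
qed

end
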